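(* Under the standing assumptions and setting of the context, let $\pi\in\Pi(\mu,\nu)$ be a $d_L$-cyclically monotone transference plan with $\int d_L\,d\pi<\infty$, and assume that for every Borel set $A$ with $\mu(A)>0$ the set $\{t>0:\mu(A_t)>0\}$ is uncountable. Then there exists a Borel map $T:X\to X$ with $T_\sharp\mu=\nu$ and $\int d_L(x,T(x))\,\mu(dx)=\int d_L\,d\pi$.
   Context: Standing assumptions: $(X,d)$ Polish; $d_L:X\times X\to[0,+\infty]$ a Borel ($d\times d$) distance, possibly $+\infty$-valued; $(X,d_L)$ geodesic and non-branching (for $r\ge0$, $d_L(x,y)=r/2$ implies $\{z:d_L(x,z)=r\}\cap\{z:d_L(y,z)=r/2\}$ has at most one point); $d_L$-geodesics are $d$-continuous and locally compact in $(X,d)$ (for each geodesic $\gamma$ and point $x$ on it, $\gamma^{-1}(\bar B_r(x))$ is compact for some $r>0$). Setting: $\mu,\nu$ Borel probabilities on $X$, $\Pi(\mu,\nu)$ couplings; $\pi$ is concentrated on a $\sigma$-compact $d_L$-cyclically monotone $\Gamma\subset\{d_L<\infty\}$ ($\sum_{i=0}^n d_L(x_i,y_i)\le\sum_{i=0}^n d_L(x_{i+1},y_i)$, $x_{n+1}=x_0$). $\Gamma'$: pairs $(x,y)$ with $I\ge0$, $(w_i,z_i)\in\Gamma$, $w_0=x$, $z_I=y$, $w_{I+1}:=w_0$, $\sum_{i=0}^I(d_L(w_{i+1},z_i)-d_L(w_i,z_i))=0$. $G:=\{(x,y):\exists(w,z)\in\Gamma',\ d_L(w,x)+d_L(x,y)+d_L(y,z)=d_L(w,z)\}$,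 $G(x):=\{y:(x,y)\in G\}$, $G^{-1}(x):=\{y:(y,x)\in G\}$, $R(x):=G(x)\cup G^{-1}(x)$; $\mathcal T:=P_1(G^{-1}\setminus\{x=y\})\cap P_1(G\setminus\{x=y\})$, $\mathcal T_e:=P_1(G^{-1}\setminus\{x=y\})\cup P_1(G\setminus\{x=y\})$. $f:\mathcal T\to\mathcal T$ is a $\mu$-measurable cross-section of $R$ on $\mathcal T$. Ray map: for $y\in f(\mathcal T)$, $g(y,t)$ is the point $x\in G(y)$ with $d_L(x,y)=t$ if $t\ge0$ and the point $x\in G^{-1}(y)$ with $d_L(x,y)=-t$ if $t<0$. For $A\subset\mathcal T_e$, $A_t:=\{g(y,s+t):g(y,s)\in A\}$. *)

theory Defs
  imports "HOL-Analysis.Analysis" "HOL-Probability.Probability"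
begin

text \<open>The Polish space (X,d) is a type of class polish_space with d = dist.
  The distance dL takes values in [0,+infinity] (type ennreal).\<close>

definition ext_distance :: "('a \<Rightarrow> 'a \<Rightarrow> ennreal) \<Rightarrow> bool" where
  "ext_distance dL \<longleftrightarrow>
     (\<forall>x y. dL x y = 0 \<longleftrightarrow> x = y) \<and>
     (\<forall>x y. dL x y = dL y x) \<and>
     (\<forall>x y z. dL x z \<le> dL x y + dL y z)"

definition dL_geodesic :: "('a \<Rightarrow> 'a \<Rightarrow> ennreal) \<Rightarrow> (real \<Rightarrow> 'a) \<Rightarrow> bool" where
  "dL_geodesic dL \<gamma> \<longleftrightarrow> dL (\<gamma> 0) (\<gamma> 1) < \<infinity> \<and>
     (\<forall>s\<in>{0..1}. \<forall>t\<in>{0..1}. dL (\<gamma> s) (\<gamma> t) = ennreal \<bar>t - s\<bar> * dL (\<gamma> 0) (\<gamma> 1))"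

definition geodesic_space :: "('a \<Rightarrow> 'a \<Rightarrow> ennreal) \<Rightarrow> bool" where
  "geodesic_space dL \<longleftrightarrow>
     (\<forall>x y. dL x y < \<infinity> \<longrightarrow> (\<exists>\<gamma>. dL_geodesic dL \<gamma> \<and> \<gamma> 0 = x \<and> \<gamma> 1 = y))"

definition non_branching :: "('a \<Rightarrow> 'a \<Rightarrow> ennreal) \<Rightarrow> bool" where
  "non_branching dL \<longleftrightarrow>
     (\<forall>x y (r::real) z1 z2. r \<ge> 0 \<longrightarrow> dL x y = ennreal (r/2) \<longrightarrow>
        dL x z1 = ennreal r \<longrightarrow> dL y z1 = ennreal (r/2) \<longrightarrow>
        dL x z2 = ennreal r \<longrightarrow> dL y z2 = ennreal (r/2) \<longrightarrow> z1 = z2)"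

definition geodesics_cont_loc_compact :: "('a::metric_space \<Rightarrow> 'a \<Rightarrow> ennreal) \<Rightarrow> bool" where
  "geodesics_cont_loc_compact dL \<longleftrightarrow>
     (\<forall>\<gamma>. dL_geodesic dL \<gamma> \<longrightarrow>
        continuous_on {0..1} \<gamma> \<and>
        (\<forall>x\<in>\<gamma> ` {0..1}. \<exists>r>0. compact ({0..1} \<inter> \<gamma> -` {z. dL x z \<le> ennreal r})))"

definition standing_assumptions :: "('a::polish_space \<Rightarrow> 'a \<Rightarrow> ennreal) \<Rightarrow> bool" where
  "standing_assumptions dL \<longleftrightarrow>
     ext_distance dL \<and>
     (\<lambda>p. dL (fst p) (snd p)) \<in> borel_measurable (borel \<Otimes>\<^sub>M borel) \<and>
     geodesic_space dL \<and> non_branching dL \<and> geodesics_cont_loc_compact dL"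

definition cyclically_monotone :: "('a \<Rightarrow> 'a \<Rightarrow> ennreal) \<Rightarrow> ('a \<times> 'a) set \<Rightarrow> bool" where
  "cyclically_monotone dL \<Gamma> \<longleftrightarrow>
     (\<forall>(n::nat) (x::nat \<Rightarrow> 'a) y. (\<forall>i\<le>n. (x i, y i) \<in> \<Gamma>) \<longrightarrow>
        (\<Sum>i\<le>n. dL (x i) (y i)) \<le> (\<Sum>i\<le>n. dL (x (if i = n then 0 else Suc i)) (y i)))"

definition sigma_compact :: "'b::topological_space set \<Rightarrow> bool" where
  "sigma_compact S \<longleftrightarrow> (\<exists>K::nat \<Rightarrow> 'b set. (\<forall>n. compact (K n)) \<and> S = (\<Union>n. K n))"

text \<open>Gamma': the condition sum (d(w_{i+1},z_i) - d(w_i,z_i)) = 0 is written as equality of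
  the two sums (equivalent since d(w_i,z_i) < infinity on Gamma).\<close>
definition Gamma' :: "('a \<Rightarrow> 'a \<Rightarrow> ennreal) \<Rightarrow> ('a \<times> 'a) set \<Rightarrow> ('a \<times> 'a) set" where
  "Gamma' dL \<Gamma> = {(x, y). \<exists>(I::nat) (w::nat \<Rightarrow> 'a) z.
      (\<forall>i\<le>I. (w i, z i) \<in> \<Gamma>) \<and> w 0 = x \<and> z I = y \<and>
      (\<Sum>i\<le>I. dL (w (if i = I then 0 else Suc i)) (z i)) = (\<Sum>i\<le>I. dL (w i) (z i))}"

definition Gset :: "('a \<Rightarrow> 'a \<Rightarrow> ennreal) \<Rightarrow> ('a \<times> 'a) set \<Rightarrow> ('a \<times> 'a) set" where
  "Gset dL \<Gamma> = {(x, y). \<exists>(w, z) \<in> Gamma' dL \<Gamma>. dL w x + dL x y + dL y z = dL w z}"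

definition Rrel :: "('a \<Rightarrow> 'a \<Rightarrow> ennreal) \<Rightarrow> ('a \<times> 'a) set \<Rightarrow> 'a \<Rightarrow> 'a set" where
  "Rrel dL \<Gamma> x = {y. (x, y) \<in> Gset dL \<Gamma>} \<union> {y. (y, x) \<in> Gset dL \<Gamma>}"

definition Tset :: "('a \<Rightarrow> 'a \<Rightarrow> ennreal) \<Rightarrow> ('a \<times> 'a) set \<Rightarrow> 'a set" where
  "Tset dL \<Gamma> = {x. \<exists>y. (y, x) \<in> Gset dL \<Gamma> \<and> x \<noteq> y} \<inter> {x. \<exists>y. (x, y) \<in> Gset dL \<Gamma> \<and> x \<noteq> y}"

definition Teset :: "('a \<Rightarrow> 'a \<Rightarrow> ennreal) \<Rightarrow> ('a \<times> 'a) set \<Rightarrow> 'a set" where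
  "Teset dL \<Gamma> = {x. \<exists>y. (y, x) \<in> Gset dL \<Gamma> \<and> x \<noteq> y} \<union> {x. \<exists>y. (x, y) \<in> Gset dL \<Gamma> \<and> x \<noteq> y}"

definition cross_section :: "('a \<Rightarrow> 'a set) \<Rightarrow> 'a set \<Rightarrow> ('a \<Rightarrow> 'a) \<Rightarrow> bool" where
  "cross_section R S f \<longleftrightarrow>
     (\<forall>x\<in>S. f x \<in> S \<and> f x \<in> R x \<and> (\<forall>y\<in>S. y \<in> R x \<longrightarrow> f y = f x))"

definition mu_measurable_on :: "'a::topological_space measure \<Rightarrow> 'a set \<Rightarrow> ('a \<Rightarrow> 'b::topological_space) \<Rightarrow> bool" where
  "mu_measurable_on \<mu> S f \<longleftrightarrow> (\<forall>B\<in>sets borel. f -` B \<inter> S \<in> sets (completion \<mu>))"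

text \<open>Ray map as a relation: ray_pt dL \<Gamma> y t x  iff  x = g(y,t) (the point is unique
  by non-branching).\<close>
definition ray_pt :: "('a \<Rightarrow> 'a \<Rightarrow> ennreal) \<Rightarrow> ('a \<times> 'a) set \<Rightarrow> 'a \<Rightarrow> real \<Rightarrow> 'a \<Rightarrow> bool" where
  "ray_pt dL \<Gamma> y t x \<longleftrightarrow>
     (t \<ge> 0 \<and> (y, x) \<in> Gset dL \<Gamma> \<and> dL x y = ennreal t) \<or>
     (t < 0 \<and> (x, y) \<in> Gset dL \<Gamma> \<and> dL x y = ennreal (- t))"

definition translate_set ::
  "('a \<Rightarrow> 'a \<Rightarrow> ennreal) \<Rightarrow> ('a \<times> 'a) set \<Rightarrow> ('a \<Rightarrow> 'a) \<Rightarrow> 'a set \<Rightarrow> real \<Rightarrow> 'a set" where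
  "translate_set dL \<Gamma> f A t =
     {x. \<exists>y\<in>f ` Tset dL \<Gamma>. \<exists>s a. ray_pt dL \<Gamma> y s a \<and> a \<in> A \<and> ray_pt dL \<Gamma> y (s + t) x}"

end

theory Submission
  imports Defs
begin

text \<open>
  Cyclical monotonicity makes G a partial order along which the distance is additive, and
  non-branching makes it linear on each ray through a point of T. Hence a point x of T is determined
  by its ray f(x) and its signed distance S(x) from f(x), and the target of a pair (x, y) is
  determined by f(x) and E = S(x) + d(x, y).

  A Borel set meeting every ray in at most one point has disjoint translates, so the hypothesis on
  translates makes it null: the law of S has no atoms along rays. Therefore S can be rearranged
  monotonically along each ray into a variable \<open>\<tau> \<ge> S\<close> such that \<open>(f, \<tau>)\<close> and \<open>(f, E)\<close> have the
  same law. Sending x to the point of its ray at position \<open>\<tau>\<close> has image measure \<open>\<nu>\<close>, and its cost is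
  unchanged because \<open>\<integral>(E - S) = \<integral>(P(S \<le> u) - P(E \<le> u)) du\<close> depends only on the laws of S and E. Points
  that the plan does not move are kept fixed.

  Neither G nor the ray map need be Borel. Measurability is obtained from inner regularity of the
  plan, which replaces images of Borel sets by countable unions of compact sets up to null sets.
\<close>

section \<open>Geodesics and betweenness\<close>

lemma ennreal_add_mono_eqD:
  fixes a a' b b' :: ennreal
  assumes "a \<le> a'" "b \<le> b'" "a' + b' \<le> a + b" "a' + b' < \<infinity>"
  shows "a = a'" "b = b'"
proof -
  have "a + b \<le> a' + b'" using assms(1,2) by (rule add_mono)
  then have fin: "a < \<infinity>" "b < \<infinity>"
    using order.strict_trans1[OF _ assms(4), of "a + b"] by simp_all
  have "b + a' \<le> b + a"
    using order.trans[OF add_left_mono[OF assms(2), of a'] assms(3)] by (simp only: add.commute)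
  moreover have "a + b' \<le> a + b"
    using order.trans[OF add_right_mono[OF assms(1), of b'] assms(3)] .
  ultimately have "b = \<infinity> \<or> a' \<le> a" "a = \<infinity> \<or> b' \<le> b"
    unfolding ennreal_add_left_cancel_le by simp_all
  then show "a = a'" "b = b'" using assms(1,2) fin by auto
qed

lemma ennreal_archimedean:
  fixes a b :: ennreal
  assumes "0 < a" "b < \<infinity>"
  obtains n where "b \<le> of_nat n * a"
proof -
  obtain r where r: "b = ennreal r" using assms(2) by (cases b) auto
  show ?thesis
  proof (cases a)
    case (real s)
    then have "0 < s" using assms(1) by simp
    then obtain n where "r < real n * s" using reals_Archimedean3 by blast
    then show ?thesis
      using that[of n] r real by (simp add: ennreal_of_nat_eq_real_of_nat ennreal_leI
          flip: ennreal_mult'')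
  next
    case top
    then show ?thesis using that[of 1] by simp
  qed
qed

locale nonbranching_geodesic_space =
  fixes d :: "'a \<Rightarrow> 'a \<Rightarrow> ennreal"
  assumes ext_distance: "ext_distance d"
    and geodesic: "geodesic_space d"
    and non_branching: "non_branching d"
begin

lemma d_eq_0_iff [simp]: "d x y = 0 \<longleftrightarrow> x = y"
  and d_commute: "d x y = d y x"
  and d_triangle: "d x z \<le> d x y + d y z"
  using ext_distance unfolding ext_distance_def by blast+

lemma d_self [simp]: "d x x = 0"
  by simp

definition between :: "'a \<Rightarrow> 'a \<Rightarrow> 'a \<Rightarrow> bool" where
  "between x u y \<longleftrightarrow> d x u + d u y = d x y"

lemma betweenI: "d x u + d u y \<le> d x y \<Longrightarrow> between x u y"
  unfolding between_def by (intro antisym d_triangle)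

lemma between_commute: "between x u y \<longleftrightarrow> between y u x"
  unfolding between_def by (simp add: d_commute add.commute)

lemma between_truncate_right:
  assumes "between x u z" "between u v z" "d v z < \<infinity>"
  shows "between x u v"
proof (rule betweenI)
  have "d v z + (d x u + d u v) = d x u + (d u v + d v z)"
    by (simp only: ac_simps)
  also have "\<dots> = d x z"
    using assms(1,2) unfolding between_def by simp
  also have "\<dots> \<le> d v z + d x v"
    using d_triangle[of x z v] by (simp add: add.commute)
  finally show "d x u + d u v \<le> d x v"
    using assms(3) by (auto simp: ennreal_add_left_cancel_le)
qed

lemma between_inner:
  assumes "d w x + d x y + d y z = d w z" "between x u y"
  shows "d w x + d x u + d u z = d w z" "d w u + d u y + d y z = d w z"
proof -
  have split: "d w x + d x u + d u y + d y z = d w z"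
    using assms unfolding between_def by (metis add.assoc)
  have "d w x + d x u + d u z \<le> d w z"
    using add_left_mono[OF d_triangle[of u z y], of "d w x + d x u"] split by (metis add.assoc)
  moreover have "d w z \<le> d w x + d x u + d u z"
    using order.trans[OF d_triangle[of w z u] add_right_mono[OF d_triangle[of w u x]]] .
  ultimately show "d w x + d x u + d u z = d w z" by (rule antisym)
  have "d w u + d u y + d y z \<le> d w z"
    using add_right_mono[OF d_triangle[of w u x], of "d u y + d y z"] split by (metis add.assoc)
  moreover have "d w z \<le> d w u + d u y + d y z"
    using order.trans[OF d_triangle[of w z u] add_left_mono[OF d_triangle[of u z y]]]
    by (simp add: add.assoc)
  ultimately show "d w u + d u y + d y z = d w z" by (rule antisym)
qed

lemma geodesic_point:
  assumes "d x y < \<infinity>" "s \<le> d x y"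
  obtains u where "between x u y" "d x u = s"
proof (cases "x = y")
  case True
  then show ?thesis using assms that[of x] by (simp add: between_def)
next
  case False
  obtain r where r: "0 \<le> r" "d x y = ennreal r"
    using assms(1) by (cases "d x y") auto
  obtain l where l: "0 \<le> l" "s = ennreal l"
    using order.strict_trans1[OF assms(2,1)] by (cases s) auto
  obtain \<gamma> where \<gamma>: "dL_geodesic d \<gamma>" "\<gamma> 0 = x" "\<gamma> 1 = y"
    using geodesic assms(1) unfolding geodesic_space_def by blast
  have speed: "d (\<gamma> s) (\<gamma> t) = ennreal (\<bar>t - s\<bar> * r)" if "s \<in> {0..1}" "t \<in> {0..1}" for s t
    using \<gamma> that r unfolding dL_geodesic_def by (simp add: ennreal_mult)
  have "r \<noteq> 0" using False r by auto
  then have "0 < r" "l \<le> r" using assms(2) r l by auto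
  have "d x (\<gamma> (l / r)) = ennreal l" "d (\<gamma> (l / r)) y = ennreal (r - l)"
    using speed[of 0 "l / r"] speed[of "l / r" 1] \<gamma> \<open>0 < r\<close> \<open>l \<le> r\<close> l(1)
    by (simp_all add: algebra_simps)
  then show ?thesis
    using that[of "\<gamma> (l / r)"] r l \<open>l \<le> r\<close> by (simp add: between_def flip: ennreal_plus)
qed

lemma short_extension_unique:
  assumes "between p x y" "between p x z" "d x y = d x z" "d x y \<le> d p x" "d p x < \<infinity>"
  shows "y = z"
proof -
  obtain b where b: "0 \<le> b" "d x y = ennreal b"
    using order.strict_trans1[OF assms(4,5)] by (cases "d x y") auto
  obtain p' where p': "between x p' p" "d x p' = d x y"
    using geodesic_point[of x p "d x y"] assms(4,5) by (auto simp: d_commute)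
  have "d p' p \<le> d x p" using p'(1) unfolding between_def by (metis le_iff_add add.commute)
  then have "d p' p < \<infinity>" using assms(5) by (simp add: d_commute order.strict_trans1)
  then have "between p' x v" if "between p x v" for v
    using between_truncate_right[of v x p p'] that p'(1) by (simp add: between_commute)
  moreover have half: "d p' x = ennreal b" "d x y = ennreal b" "d x z = ennreal b"
    using assms(3) p'(2) b by (auto simp: d_commute[of p'])
  ultimately have "d p' y = ennreal (2 * b)" "d p' z = ennreal (2 * b)"
    using assms(1,2) b(1) unfolding between_def by (metis ennreal_plus mult_2)+
  then show ?thesis
    using non_branching[unfolded non_branching_def, rule_format, of "2 * b" p' x y z] half b(1)
    by simp
qed

lemma common_extension_point:
  assumes "d p x < d x y" "d x y < \<infinity>"
    and "between p x y" "between p x z" "d x y = d x z"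
  obtains u where "between x u y" "between x u z" "d x u = d p x" "d u y = d u z" "d u y < \<infinity>"
proof -
  obtain u where u: "between x u y" "d x u = d p x"
    using assms(2) less_imp_le[OF assms(1)] by (rule geodesic_point)
  have "d x z < \<infinity>" "d p x \<le> d x z" using assms(1,2,5) by simp_all
  then obtain v where v: "between x v z" "d x v = d p x"
    by (rule geodesic_point)
  have px: "d p x < \<infinity>" using assms(1,2) by (rule order.strict_trans)
  have sum: "d p x + d u y = d x y" "d p x + d v z = d x y"
    using u v assms(5) unfolding between_def by simp_all
  then have "d p x + d u y < \<infinity>" "d p x + d v z < \<infinity>"
    using assms(2) by simp_all
  then have fin: "d u y < \<infinity>" "d v z < \<infinity>" by simp_all
  have tails: "d u y = d v z"
    using sum px ennreal_add_left_cancel[of "d p x" "d u y" "d v z"] by auto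
  have "between p x u" "between p x v"
    using between_truncate_right assms(3,4) u(1) v(1) fin by blast+
  then have "u = v"
    using short_extension_unique[of p x u v] u(2) v(2) px by simp
  then show ?thesis using that u v(1) tails fin(1) by blast
qed

lemma extension_unique:
  assumes "p \<noteq> x" "d p x < \<infinity>" "d x y < \<infinity>"
    and "between p x y" "between p x z" "d x y = d x z"
  shows "y = z"
proof -
  have "0 < d p x" using assms(1) by (simp add: zero_less_iff_neq_zero)
  then obtain n where "d x y \<le> of_nat n * d p x"
    using assms(3) by (rule ennreal_archimedean)
  then show ?thesis using assms
  proof (induction n arbitrary: p x)
    case 0
    then show ?case by (metis d_eq_0_iff le_zero_eq mult_zero_left of_nat_0)
  next
    case (Suc n)
    show ?case
    proof (cases "d x y \<le> d p x")
      case True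
      then show ?thesis using short_extension_unique Suc.prems by blast
    next
      case False
      then obtain u where u: "between x u y" "between x u z" "d x u = d p x" "d u y = d u z"
        "d u y < \<infinity>"
        using common_extension_point[of p x y z] Suc.prems by (auto simp: not_le)
      have "d p x + d u y \<le> d p x + of_nat n * d p x"
        using Suc.prems(1) u(1,3) unfolding between_def by (simp add: distrib_right)
      then have "d u y \<le> of_nat n * d x u"
        using u(3) Suc.prems(3) by (simp add: ennreal_add_left_cancel_le flip: less_top)
      moreover have "x \<noteq> u" using u(3) \<open>p \<noteq> x\<close> by auto
      ultimately show ?thesis
        using Suc.IH[of u x] u Suc.prems(3) by simp
    qed
  qed
qed

lemma between_swap:
  assumes fin: "d w z < \<infinity>" "d w' z' < \<infinity>"
    and through: "d w x + d x y + d y z = d w z" "d w' y + d y y' + d y' z' = d w' z'"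
    and swap: "d w z + d w' z' \<le> d w' z + d w z'"
  shows "between x y y'" "d w x + d x y' + d y' z' = d w z'" "d w' z + d w z' = d w z + d w' z'"
proof -
  have total: "(d w' y + d y z) + (d w x + (d x y + d y y') + d y' z') = d w z + d w' z'"
    unfolding through[symmetric] by (simp only: ac_simps)
  then have finite: "(d w' y + d y z) + (d w x + (d x y + d y y') + d y' z') < \<infinity>"
    using fin by simp
  have direct: "d w z' \<le> d w x + d x y' + d y' z'"
    using order.trans[OF d_triangle[of w z' y'] add_right_mono[OF d_triangle[of w y' x]]] .
  have detour: "d w x + d x y' + d y' z' \<le> d w x + (d x y + d y y') + d y' z'"
    by (intro add_mono order.refl d_triangle)
  note eqs = ennreal_add_mono_eqD[OF d_triangle[of w' z y] order.trans[OF direct detour] _ finite,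
      unfolded total, OF swap]
  show "d w' z + d w z' = d w z + d w' z'"
    using total eqs by simp
  show wz': "d w x + d x y' + d y' z' = d w z'"
    using detour[folded eqs(2)] direct by (rule antisym)
  have "(d w x + d y' z') + d x y' = (d w x + d y' z') + (d x y + d y y')"
    using wz' eqs(2) by (simp only: ac_simps)
  then have "d w x + d y' z' = \<top> \<or> d x y' = d x y + d y y'"
    by (simp only: ennreal_add_left_cancel infinity_ennreal_def)
  then show "between x y y'"
    using finite unfolding between_def by (auto simp: top_unique)
qed

end

section \<open>Ray orders\<close>

text \<open>The axioms are invariant under reversing G, so each statement about what lies beyond a point
  also yields its mirror image about what lies before it.\<close>

locale ray_order = nonbranching_geodesic_space +
  fixes G :: "('a \<times> 'a) set"
  assumes G_finite: "(x, y) \<in> G \<Longrightarrow> d x y < \<infinity>"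
    and G_trans: "(x, y) \<in> G \<Longrightarrow> (y, z) \<in> G \<Longrightarrow> (x, z) \<in> G"
    and G_between: "(x, y) \<in> G \<Longrightarrow> (y, z) \<in> G \<Longrightarrow> between x y z"
    and G_convex: "(x, y) \<in> G \<Longrightarrow> between x u y \<Longrightarrow> (x, u) \<in> G \<and> (u, y) \<in> G"
begin

lemma ray_order_converse: "ray_order d (G\<inverse>)"
proof
  fix x y z u
  show "d x y < \<infinity>" if "(x, y) \<in> G\<inverse>"
    using G_finite that by (metis converseD d_commute)
  show "(x, z) \<in> G\<inverse>" "between x y z" if "(x, y) \<in> G\<inverse>" "(y, z) \<in> G\<inverse>"
    using G_trans[of z y x] G_between[of z y x] that between_commute[of x y z] by simp_all
  show "(x, u) \<in> G\<inverse> \<and> (u, y) \<in> G\<inverse>" if "(x, y) \<in> G\<inverse>" "between x u y"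
    using G_convex[of y x u] that between_commute[of x u y] by simp
qed

lemma forward_linear:
  assumes "(p, x) \<in> G" "p \<noteq> x" "(x, y) \<in> G" "(x, z) \<in> G" "d x y \<le> d x z"
  shows "(y, z) \<in> G"
proof -
  obtain u where u: "between x u z" "d x u = d x y"
    using geodesic_point[OF G_finite[OF assms(4)] assms(5)] .
  then have xu: "(x, u) \<in> G" and uz: "(u, z) \<in> G" using G_convex[OF assms(4)] by blast+
  have "y = u"
    using extension_unique[OF assms(2) G_finite[OF assms(1)] G_finite[OF assms(3)]
        G_between[OF assms(1,3)] G_between[OF assms(1) xu]] u(2) by simp
  with uz show ?thesis by simp
qed

lemma backward_linear:
  assumes "(x, p) \<in> G" "x \<noteq> p" "(y, x) \<in> G" "(z, x) \<in> G" "d y x \<le> d z x"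
  shows "(z, y) \<in> G"
  using ray_order.forward_linear[OF ray_order_converse, of p x y z] assms by (simp add: d_commute)

definition inner :: "'a set" where
  "inner = {x. (\<exists>p. (p, x) \<in> G \<and> p \<noteq> x) \<and> (\<exists>p. (x, p) \<in> G \<and> x \<noteq> p)}"

definition at_position :: "'a \<Rightarrow> real \<Rightarrow> 'a \<Rightarrow> bool" where
  "at_position y t x \<longleftrightarrow>
    (if 0 \<le> t then (y, x) \<in> G \<and> d y x = ennreal t else (x, y) \<in> G \<and> d x y = ennreal (- t))"

lemma inner_converse: "ray_order.inner (G\<inverse>) = inner"
  unfolding ray_order.inner_def[OF ray_order_converse] inner_def by blast

lemma at_position_converse: "ray_order.at_position d (G\<inverse>) y (- t) x \<longleftrightarrow> at_position y t x"
  unfolding ray_order.at_position_def[OF ray_order_converse] at_position_def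
  using d_commute[of x y] by (cases "t = 0") auto

lemma at_position_exists: "(y, x) \<in> G \<or> (x, y) \<in> G \<Longrightarrow> \<exists>t. at_position y t x"
proof (elim disjE)
  assume "(y, x) \<in> G"
  then show ?thesis
    using G_finite[of y x] unfolding at_position_def by (intro exI[of _ "enn2real (d y x)"]) simp
next
  assume yx: "(x, y) \<in> G"
  then obtain t where "0 \<le> t" "d x y = ennreal t"
    using G_finite[of x y] by (cases "d x y") auto
  then show ?thesis
    using yx unfolding at_position_def by (intro exI[of _ "- t"]) auto
qed

lemma at_position_dist: "at_position y t x \<Longrightarrow> d y x = ennreal \<bar>t\<bar>"
  unfolding at_position_def using d_commute[of x y] by (cases "0 \<le> t") simp_all

lemma at_position_diff_nonneg:
  assumes "y \<in> inner" "at_position y s x" "at_position y t x'" "s \<le> t" "0 \<le> s"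
  shows "(x, x') \<in> G \<and> d x x' = ennreal (t - s)"
proof -
  have after: "(y, x) \<in> G" "d y x = ennreal s" "(y, x') \<in> G" "d y x' = ennreal t"
    using assms unfolding at_position_def by auto
  obtain p where "(p, y) \<in> G" "p \<noteq> y" using assms(1) unfolding inner_def by blast
  then have xx': "(x, x') \<in> G"
    using forward_linear[of p y x x'] after assms(4) by (simp add: ennreal_leI)
  have "ennreal s + d x x' = ennreal s + ennreal (t - s)"
    using G_between[OF after(1) xx'] after assms(4,5) unfolding between_def
    by (simp flip: ennreal_plus)
  with xx' show ?thesis by simp
qed

lemma at_position_diff:
  assumes "y \<in> inner" "at_position y s x" "at_position y t x'" "s \<le> t"
  shows "(x, x') \<in> G" "d x x' = ennreal (t - s)"
proof -
  consider (both_after) "0 \<le> s" | (opposite) "s < 0" "0 \<le> t" | (both_before) "t < 0" by linarith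
  then have "(x, x') \<in> G \<and> d x x' = ennreal (t - s)"
  proof cases
    case both_after
    then show ?thesis using at_position_diff_nonneg assms by blast
  next
    case opposite
    then have through: "(x, y) \<in> G" "d x y = ennreal (- s)" "(y, x') \<in> G" "d y x' = ennreal t"
      using assms unfolding at_position_def by auto
    then show ?thesis
      using G_trans[OF through(1,3)] G_between[OF through(1,3)] through opposite
      unfolding between_def by (simp flip: ennreal_plus)
  next
    case both_before
    then show ?thesis
      using ray_order.at_position_diff_nonneg[OF ray_order_converse, of y "- t" x' "- s" x] assms
      by (simp add: at_position_converse inner_converse d_commute)
  qed
  then show "(x, x') \<in> G" "d x x' = ennreal (t - s)" by auto
qed

lemma at_position_unique:
  assumes "y \<in> inner" "at_position y t x" "at_position y t x'"
  shows "x = x'"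
proof -
  have "d x x' = ennreal (t - t)" using at_position_diff(2) assms by blast
  then show ?thesis by simp
qed

lemma at_position_add:
  assumes "x \<in> inner" "at_position y s x" "(x, z) \<in> G" "d x z = ennreal t" "0 \<le> t"
  shows "at_position y (s + t) z"
proof (cases "0 \<le> s")
  case True
  then have yx: "(y, x) \<in> G" "d y x = ennreal s"
    using assms(2) unfolding at_position_def by simp_all
  have "d y z = ennreal s + ennreal t"
    using G_between[OF yx(1) assms(3)] yx(2) assms(4) unfolding between_def by simp
  then have "d y z = ennreal (s + t)"
    using True assms(5) by simp
  then show ?thesis
    using G_trans[OF yx(1) assms(3)] assms(5) True unfolding at_position_def by simp
next
  case False
  then have "(x, y) \<in> G" "d x y = ennreal (- s)"
    using assms(2) unfolding at_position_def by simp_all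
  then have positions: "at_position x (- s) y" "at_position x t z"
    using assms(3-5) False by (simp_all add: at_position_def)
  show ?thesis
  proof (cases "0 \<le> s + t")
    case True
    then show ?thesis
      using at_position_diff[OF assms(1) positions] by (simp add: at_position_def add.commute)
  next
    case False
    then show ?thesis
      using at_position_diff[OF assms(1) positions(2,1)] by (simp add: at_position_def)
  qed
qed

end

section \<open>The transport rays of a cyclically monotone set\<close>

locale transport_rays = nonbranching_geodesic_space dL
  for dL :: "'a \<Rightarrow> 'a \<Rightarrow> ennreal" +
  fixes \<Gamma> :: "('a \<times> 'a) set"
  assumes monotone: "cyclically_monotone dL \<Gamma>"
    and \<Gamma>_finite: "\<Gamma> \<subseteq> {(x, y). dL x y < \<infinity>}"
begin

text \<open>The last two arguments of a chain from x to y record its swapped cost, without the closing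
  term \<open>dL x y\<close>, and its cost.\<close>

inductive chain :: "'a \<Rightarrow> 'a \<Rightarrow> ennreal \<Rightarrow> ennreal \<Rightarrow> bool" where
  single: "(x, y) \<in> \<Gamma> \<Longrightarrow> chain x y 0 (dL x y)"
| snoc: "chain x y C V \<Longrightarrow> (x', y') \<in> \<Gamma> \<Longrightarrow> chain x y' (C + dL x' y) (V + dL x' y')"

lemma sum_cyclic:
  "(\<Sum>i\<le>I. dL (w (if i = I then 0 else Suc i)) (z i)) =
    (\<Sum>i<I. dL (w (Suc i)) (z i)) + dL (w (0::nat)) (z I)"
  by (simp add: lessThan_Suc_atMost[symmetric])

lemma chain_of_sequence:
  assumes "\<forall>i\<le>I. (w i, z i) \<in> \<Gamma>"
  shows "chain (w 0) (z I) (\<Sum>i<I. dL (w (Suc i)) (z i)) (\<Sum>i\<le>I. dL (w i) (z i))"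
  using assms
proof (induction I)
  case 0
  then show ?case using single by simp
next
  case (Suc I)
  then show ?case
    using snoc[of "w 0" "z I" _ _ "w (Suc I)" "z (Suc I)"] by simp
qed

lemma sequence_of_chain:
  assumes "chain x y C V"
  obtains I w z where "\<forall>i\<le>I. (w i, z i) \<in> \<Gamma>" "w 0 = x" "z I = y"
    "C = (\<Sum>i<I. dL (w (Suc i)) (z i))" "V = (\<Sum>i\<le>I. dL (w i) (z i))"
  using assms
proof (induction arbitrary: thesis)
  case (single x y)
  then show ?case using single.prems[of 0 "\<lambda>_. x" "\<lambda>_. y"] by simp
next
  case (snoc x y C V x' y')
  obtain I w z where wz: "\<forall>i\<le>I. (w i, z i) \<in> \<Gamma>" "w 0 = x" "z I = y"
    "C = (\<Sum>i<I. dL (w (Suc i)) (z i))" "V = (\<Sum>i\<le>I. dL (w i) (z i))"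
    using snoc.IH by blast
  let ?w = "w(Suc I := x')" and ?z = "z(Suc I := y')"
  have "(\<Sum>i<I. dL (?w (Suc i)) (?z i)) = C" "(\<Sum>i\<le>I. dL (?w i) (?z i)) = V"
    unfolding wz by (auto intro!: sum.cong)
  then show ?case
    using wz snoc.hyps snoc.prems[of "Suc I" ?w ?z] by (auto simp: le_Suc_eq)
qed

lemma Gamma'_iff: "(x, y) \<in> Gamma' dL \<Gamma> \<longleftrightarrow> (\<exists>C V. chain x y C V \<and> C + dL x y = V)"
proof
  assume "(x, y) \<in> Gamma' dL \<Gamma>"
  then obtain I w z where wz: "\<forall>i\<le>I. (w i, z i) \<in> \<Gamma>" "w 0 = x" "z I = y"
    "(\<Sum>i<I. dL (w (Suc i)) (z i)) + dL (w 0) (z I) = (\<Sum>i\<le>I. dL (w i) (z i))"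
    unfolding Gamma'_def sum_cyclic by blast
  show "\<exists>C V. chain x y C V \<and> C + dL x y = V"
    using chain_of_sequence[OF wz(1)] wz(2-4) by blast
next
  assume "\<exists>C V. chain x y C V \<and> C + dL x y = V"
  then obtain C V where "chain x y C V" "C + dL x y = V" by blast
  then show "(x, y) \<in> Gamma' dL \<Gamma>"
    unfolding Gamma'_def sum_cyclic by (elim sequence_of_chain) blast
qed

lemma chain_append:
  assumes "chain x' y' C' V'" "chain x y C V"
  shows "chain x y' (C + dL x' y + C') (V + V')"
  using assms(1)
proof induction
  case (single x' y')
  then show ?case using snoc[OF assms(2)] by simp
next
  case (snoc x' y' C' V' x'' y'')
  then show ?case using chain.snoc[OF snoc.IH snoc.hyps(2)] by (simp add: ac_simps)
qed

lemma chain_monotone: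
  assumes "chain x y C V"
  shows "V \<le> C + dL x y"
  using assms
proof (rule sequence_of_chain)
  fix I w z
  assume "\<forall>i\<le>I. (w i, z i) \<in> \<Gamma>" "w 0 = x" "z I = y"
    "C = (\<Sum>i<I. dL (w (Suc i)) (z i))" "V = (\<Sum>i\<le>I. dL (w i) (z i))"
  then show "V \<le> C + dL x y"
    using monotone[unfolded cyclically_monotone_def sum_cyclic] by blast
qed

lemma chain_finite: "chain x y C V \<Longrightarrow> V < \<infinity>"
  by (induction rule: chain.induct) (use \<Gamma>_finite in auto)

lemma Gamma'_finite:
  assumes "(w, z) \<in> Gamma' dL \<Gamma>"
  shows "dL w z < \<infinity>"
proof -
  obtain C V where "chain w z C V" "C + dL w z = V"
    using assms unfolding Gamma'_iff by blast
  with chain_finite have "C + dL w z < \<infinity>" by blast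
  then show ?thesis by simp
qed

text \<open>Joining the two chains exchanges their end points.\<close>

lemma Gamma'_swap:
  assumes "(w, z) \<in> Gamma' dL \<Gamma>" "(w', z') \<in> Gamma' dL \<Gamma>"
  shows "dL w z + dL w' z' \<le> dL w' z + dL w z'"
    and "dL w' z + dL w z' = dL w z + dL w' z' \<Longrightarrow> (w, z') \<in> Gamma' dL \<Gamma>"
proof -
  obtain C V where chain: "chain w z C V" and closed: "C + dL w z = V"
    using assms(1) unfolding Gamma'_iff by blast
  obtain C' V' where chain': "chain w' z' C' V'" and closed': "C' + dL w' z' = V'"
    using assms(2) unfolding Gamma'_iff by blast
  note joined = chain_append[OF chain' chain]
  have cost: "V + V' = (C + C') + (dL w z + dL w' z')"
    unfolding closed[symmetric] closed'[symmetric] by (simp only: ac_simps)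
  have swapped_cost: "C + dL w' z + C' + dL w z' = (C + C') + (dL w' z + dL w z')"
    by (simp only: ac_simps)
  have "V + V' < \<infinity>" using chain_finite[OF chain] chain_finite[OF chain'] by simp
  then have "C + C' < \<infinity>" unfolding cost by simp
  moreover have "(C + C') + (dL w z + dL w' z') \<le> (C + C') + (dL w' z + dL w z')"
    using chain_monotone[OF joined] unfolding cost swapped_cost .
  ultimately show "dL w z + dL w' z' \<le> dL w' z + dL w z'"
    unfolding ennreal_add_left_cancel_le by auto
  assume "dL w' z + dL w z' = dL w z + dL w' z'"
  then have "C + dL w' z + C' + dL w z' = V + V'"
    unfolding cost swapped_cost by simp
  with joined show "(w, z') \<in> Gamma' dL \<Gamma>" unfolding Gamma'_iff by blast
qed

lemma GsetE:
  assumes "(x, y) \<in> Gset dL \<Gamma>"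
  obtains w z where "(w, z) \<in> Gamma' dL \<Gamma>" "dL w x + dL x y + dL y z = dL w z"
  using assms unfolding Gset_def by blast

lemma Gset_trans:
  assumes "(x, y) \<in> Gset dL \<Gamma>" "(y, y') \<in> Gset dL \<Gamma>"
  shows "(x, y') \<in> Gset dL \<Gamma>" "between x y y'"
proof -
  obtain w z where wz: "(w, z) \<in> Gamma' dL \<Gamma>" "dL w x + dL x y + dL y z = dL w z"
    using assms(1) by (rule GsetE)
  obtain w' z' where wz': "(w', z') \<in> Gamma' dL \<Gamma>" "dL w' y + dL y y' + dL y' z' = dL w' z'"
    using assms(2) by (rule GsetE)
  note swap = between_swap[OF Gamma'_finite[OF wz(1)] Gamma'_finite[OF wz'(1)] wz(2) wz'(2)
      Gamma'_swap(1)[OF wz(1) wz'(1)]]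
  show "between x y y'" by (fact swap(1))
  show "(x, y') \<in> Gset dL \<Gamma>"
    using Gamma'_swap(2)[OF wz(1) wz'(1) swap(3)] swap(2) unfolding Gset_def by blast
qed

sublocale ray_order dL "Gset dL \<Gamma>"
proof
  fix x y z u assume xy: "(x, y) \<in> Gset dL \<Gamma>"
  obtain w z where wz: "(w, z) \<in> Gamma' dL \<Gamma>" "dL w x + dL x y + dL y z = dL w z"
    using xy by (rule GsetE)
  have "dL w x + dL x y + dL y z < \<infinity>" unfolding wz(2) using wz(1) by (rule Gamma'_finite)
  then show "dL x y < \<infinity>" by simp
  show "(x, u) \<in> Gset dL \<Gamma> \<and> (u, y) \<in> Gset dL \<Gamma>" if "between x u y"
    using between_inner[OF wz(2) that] wz(1) unfolding Gset_def by blast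
qed (fact Gset_trans)+

lemma \<Gamma>_subset_Gset: "\<Gamma> \<subseteq> Gset dL \<Gamma>"
proof
  fix p assume "p \<in> \<Gamma>"
  then have "p \<in> Gamma' dL \<Gamma>"
    using single[of "fst p" "snd p"] Gamma'_iff[of "fst p" "snd p"] by (metis add_0 prod.collapse)
  then show "p \<in> Gset dL \<Gamma>" unfolding Gset_def by force
qed

lemma Tset_eq_inner: "Tset dL \<Gamma> = inner"
  unfolding Tset_def inner_def by blast

lemma ray_pt_eq_at_position: "ray_pt dL \<Gamma> = at_position"
proof (intro ext)
  fix y t x
  show "ray_pt dL \<Gamma> y t x = at_position y t x"
    unfolding ray_pt_def at_position_def using d_commute[of x y] by (cases "0 \<le> t") simp_all
qed

end

section \<open>Signed positions along the rays\<close>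

locale ray_section = transport_rays +
  fixes f :: "'a \<Rightarrow> 'a"
  assumes cross_section: "cross_section (Rrel dL \<Gamma>) (Tset dL \<Gamma>) f"
begin

abbreviation "G \<equiv> Gset dL \<Gamma>"
abbreviation "T \<equiv> Tset dL \<Gamma>"

lemma section_in_T: "x \<in> T \<Longrightarrow> f x \<in> T"
  and section_related: "x \<in> T \<Longrightarrow> (f x, x) \<in> G \<or> (x, f x) \<in> G"
  and section_eq: "x \<in> T \<Longrightarrow> y \<in> T \<Longrightarrow> (x, y) \<in> G \<Longrightarrow> f x = f y"
  using cross_section unfolding cross_section_def Rrel_def by blast+

definition position :: "'a \<Rightarrow> real" where
  "position x = (SOME t. at_position (f x) t x)"

lemma at_position_position: "x \<in> T \<Longrightarrow> at_position (f x) (position x) x"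
  unfolding position_def by (rule someI_ex[OF at_position_exists[OF section_related]])

lemma at_position_target:
  assumes "x \<in> T" "(x, y) \<in> G"
  shows "at_position (f x) (position x + enn2real (dL x y)) y"
  using at_position_add[OF _ at_position_position assms(2)] G_finite[OF assms(2)] assms(1)
  by (simp add: Tset_eq_inner)

lemma position_inj:
  assumes "x \<in> T" "x' \<in> T" "f x = f x'" "position x = position x'"
  shows "x = x'"
  using at_position_unique[of "f x" "position x" x x'] at_position_position[OF assms(1)]
    at_position_position[OF assms(2)] section_in_T[OF assms(1)] assms(3,4)
  by (simp add: Tset_eq_inner)

lemma target_unique:
  assumes "x \<in> T" "x' \<in> T" "f x = f x'" "(x, y) \<in> G" "(x', y') \<in> G"
    and "position x + enn2real (dL x y) = position x' + enn2real (dL x' y')"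
  shows "y = y'"
  using at_position_unique[of "f x" _ y y'] at_position_target[OF assms(1,4)]
    at_position_target[OF assms(2,5)] section_in_T[OF assms(1)] assms(3,6)
  by (simp add: Tset_eq_inner)

lemma dist_to_target:
  assumes "x \<in> T" "x' \<in> T" "f x = f x'" "(x', y') \<in> G"
    and "position x \<le> position x' + enn2real (dL x' y')"
  shows "dL x y' = ennreal (position x' + enn2real (dL x' y') - position x)"
  using at_position_diff(2)[of "f x" "position x" x _ y'] at_position_position[OF assms(1)]
    at_position_target[OF assms(2,4)] section_in_T[OF assms(1)] assms(3,5)
  by (simp add: Tset_eq_inner)

text \<open>The sign of the position is read off from distances alone, which makes it
  measurable although G need not be a Borel set.\<close>

lemma position_eq_dist:
  assumes "x \<in> T" "(x, y) \<in> G" "x \<noteq> y"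
  shows "position x = (if dL (f x) y = dL (f x) x + dL x y then enn2real (dL (f x) x)
    else - enn2real (dL (f x) x))"
proof -
  obtain a where a: "0 \<le> a" "dL x y = ennreal a"
    using G_finite[OF assms(2)] by (cases "dL x y") auto
  then have "0 < a" using assms(3) by (cases "a = 0") auto
  have dist: "dL (f x) x = ennreal \<bar>position x\<bar>" "dL (f x) y = ennreal \<bar>position x + a\<bar>"
    using at_position_dist[OF at_position_position[OF assms(1)]]
      at_position_dist[OF at_position_target[OF assms(1,2)]] a by simp_all
  then have "dL (f x) y = dL (f x) x + dL x y \<longleftrightarrow> \<bar>position x + a\<bar> = \<bar>position x\<bar> + a"
    using a by (simp flip: ennreal_plus)
  also have "\<dots> \<longleftrightarrow> 0 \<le> position x" using \<open>0 < a\<close> by linarith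
  finally show ?thesis using dist(1) by simp
qed

lemma translate_setE:
  assumes "x \<in> translate_set dL \<Gamma> f A t" "0 \<le> t"
  obtains a where "a \<in> A" "(a, x) \<in> G" "dL a x = ennreal t"
proof -
  obtain y s a where "y \<in> T" "at_position y s a" "at_position y (s + t) x" "a \<in> A"
    using assms(1) section_in_T unfolding translate_set_def ray_pt_eq_at_position by blast
  then show ?thesis
    using that at_position_diff[of y s a "s + t" x] assms(2) by (simp add: Tset_eq_inner)
qed

end

section \<open>Measure-theoretic tools\<close>

lemma pred_Collect_borel_prod:
  fixes P :: "'a::second_countable_topology \<times> 'b::second_countable_topology \<Rightarrow> bool"
  assumes "Measurable.pred (borel \<Otimes>\<^sub>M borel) P"
  shows "{p. P p} \<in> sets borel"
  using assms unfolding borel_prod by (rule pred_Collect_borel)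

lemma sets_borel_prod_lessThan:
  "sets ((borel :: 'a::topological_space measure) \<Otimes>\<^sub>M (borel :: real measure)) =
    sigma_sets UNIV {B \<times> C |B C. B \<in> sets borel \<and> C \<in> range lessThan}"
proof -
  let ?U = "range (\<lambda>n. {..<real n})"
  have "\<Union>?U = UNIV" by (auto intro: reals_Archimedean2)
  then show ?thesis
    using sets_pair_eq[of "sets borel" "borel :: 'a measure" "{UNIV}" "range lessThan"
        "borel :: real measure" ?U]
      sets.sigma_sets_eq[of "borel :: 'a measure"]
    by (auto simp: borel_Iio)
qed

lemma (in finite_measure) countable_positive_disjoint_family:
  assumes disj: "disjoint_family_on D I" and meas: "\<And>i. i \<in> I \<Longrightarrow> D i \<in> sets M"
    and pos: "\<And>i. i \<in> I \<Longrightarrow> 0 < emeasure M (D i)"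
  shows "countable I"
proof -
  have "(\<Sum>i\<in>F. measure M (D i)) \<le> measure M (space M)" if F: "F \<subseteq> I" "finite F" for F
  proof -
    have "(\<Sum>i\<in>F. measure M (D i)) = measure M (\<Union>i\<in>F. D i)"
      using F meas disjoint_family_on_mono[OF F(1) disj]
      by (intro finite_measure_finite_Union[symmetric]) auto
    also have "\<dots> \<le> measure M (space M)" by (rule bounded_measure)
    finally show ?thesis .
  qed
  then have "(\<lambda>i. measure M (D i)) summable_on I"
    by (intro nonneg_bdd_above_summable_on) (auto intro!: bdd_aboveI2)
  then have "countable {i \<in> I. measure M (D i) \<noteq> 0}" by (rule summable_countable_real)
  moreover have "measure M (D i) \<noteq> 0" if "i \<in> I" for i
    using pos[OF that] by (simp add: emeasure_eq_measure)
  then have "{i \<in> I. measure M (D i) \<noteq> 0} = I" by blast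
  ultimately show ?thesis by simp
qed

lemma inner_compact_exhaustion:
  fixes M :: "'a::{second_countable_topology, complete_space} measure"
  assumes "finite_measure M" and sets_M: "sets M = sets borel" and D: "D \<in> sets borel"
  obtains K :: "nat \<Rightarrow> 'a set" where "\<And>n. compact (K n)" "(\<Union>n. K n) \<subseteq> D"
    "AE x in M. x \<in> D \<longrightarrow> x \<in> (\<Union>n. K n)"
proof -
  interpret finite_measure M by fact
  let ?A = "{K. K \<subseteq> D \<and> compact K}"
  have "?A \<noteq> {}" by auto
  from ennreal_SUP_countable_SUP[OF this, of "emeasure M"]
  obtain v :: "nat \<Rightarrow> ennreal" where v: "range v \<subseteq> emeasure M ` ?A"
    "Sup (emeasure M ` ?A) = (SUP n. v n)"
    by blast
  then have "\<forall>n. \<exists>K. K \<in> ?A \<and> v n = emeasure M K" by blast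
  then obtain K where K: "\<And>n. K n \<subseteq> D" "\<And>n. compact (K n)" "\<And>n. v n = emeasure M (K n)"
    by (metis (mono_tags, lifting) mem_Collect_eq)
  have [measurable]: "K n \<in> sets M" for n
    using K(2) sets_M by (simp add: borel_compact)
  have [measurable]: "D \<in> sets M" using D sets_M by simp
  have "emeasure M D = (SUP n. emeasure M (K n))"
    using inner_regular[OF sets_M _ D] v(2) K(3) by (simp add: emeasure_finite)
  also have "\<dots> \<le> emeasure M (\<Union>n. K n)"
    by (intro SUP_least emeasure_mono) auto
  finally have "emeasure M D \<le> emeasure M (\<Union>n. K n)" .
  moreover have "emeasure M (D - (\<Union>n. K n)) = emeasure M D - emeasure M (\<Union>n. K n)"
    using K(1) by (intro emeasure_Diff) auto
  ultimately have "emeasure M (D - (\<Union>n. K n)) = 0"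
    by (simp add: diff_eq_0_iff_ennreal emeasure_finite less_top[symmetric])
  then have "D - (\<Union>n. K n) \<in> null_sets M" by (intro null_setsI) measurable
  then have "AE x in M. x \<notin> D - (\<Union>n. K n)" by (rule AE_not_in)
  then have "AE x in M. x \<in> D \<longrightarrow> x \<in> (\<Union>n. K n)" by eventually_elim blast
  then show ?thesis using that[of K] K(1,2) by blast
qed

text \<open>Lusin's theorem, by inner regularity of the image measure on the graph: over a compact part
  of the graph the projection is a homeomorphism.\<close>

lemma Lusin_compact_exhaustion:
  fixes M :: "'a::{second_countable_topology, complete_space} measure"
    and v :: "'a \<Rightarrow> 'b::{second_countable_topology, complete_space}"
  assumes "finite_measure M" and sets_M: "sets M = sets borel"
    and [measurable]: "v \<in> borel_measurable borel" "D \<in> sets borel"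
  obtains K :: "nat \<Rightarrow> 'a set" where "\<And>n. compact (K n)" "\<And>n. continuous_on (K n) v"
    "(\<Union>n. K n) \<subseteq> D" "AE x in M. x \<in> D \<longrightarrow> x \<in> (\<Union>n. K n)"
proof -
  interpret finite_measure M by fact
  have "(\<lambda>x. (x, v x)) \<in> borel \<rightarrow>\<^sub>M borel \<Otimes>\<^sub>M borel" by measurable
  then have W: "(\<lambda>x. (x, v x)) \<in> M \<rightarrow>\<^sub>M borel"
    unfolding borel_prod by (simp add: measurable_cong_sets[OF sets_M refl])
  define graph where "graph = {p. fst p \<in> D \<and> snd p = v (fst p)}"
  have graph: "graph \<in> sets borel"
    unfolding graph_def by (rule pred_Collect_borel_prod) measurable
  obtain L where L: "\<And>n::nat. compact (L n)" "(\<Union>n. L n) \<subseteq> graph"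
    "AE p in distr M borel (\<lambda>x. (x, v x)). p \<in> graph \<longrightarrow> p \<in> (\<Union>n. L n)"
    using inner_compact_exhaustion[OF finite_measure_distr[OF W] _ graph] by auto
  have L_graph: "(fst p, v (fst p)) = p" "fst p \<in> D" if "p \<in> L n" for p n
  proof -
    have "p \<in> graph" using that L(2) by blast
    then show "(fst p, v (fst p)) = p" "fst p \<in> D"
      unfolding graph_def by (simp_all add: prod_eq_iff)
  qed
  have compact: "compact (fst ` L n)" for n
    using L(1) by (intro compact_continuous_image[OF continuous_on_fst[OF continuous_on_id]])
  have "continuous_on (fst ` L n) (\<lambda>x. (x, v x))" for n
    using L(1) L_graph(1)
    by (intro continuous_on_inv[OF continuous_on_fst[OF continuous_on_id]]) auto
  then have cont: "continuous_on (fst ` L n) v" for n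
    using continuous_on_snd by fastforce
  have sub: "(\<Union>n. fst ` L n) \<subseteq> D" using L_graph(2) by blast
  have "AE x in M. x \<in> D \<longrightarrow> x \<in> (\<Union>n. fst ` L n)"
    using AE_distrD[OF W L(3)] by eventually_elim (force simp: graph_def)
  then show ?thesis using that[of "\<lambda>n. fst ` L n"] compact cont sub by blast
qed

lemma borel_measurableI_closed:
  fixes f :: "'a \<Rightarrow> 'b::topological_space"
  assumes "\<And>C. closed C \<Longrightarrow> f -` C \<inter> space M \<in> sets M"
  shows "f \<in> borel_measurable M"
  unfolding borel_eq_closed by (rule measurable_measure_of) (use assms in auto)

lemma image_preimage_borel:
  fixes u :: "'a::t2_space \<Rightarrow> 'b::t2_space" and v :: "'a \<Rightarrow> 'c::topological_space"
  assumes "\<And>n::nat. compact (K n)" "\<And>n. continuous_on (K n) u" "\<And>n. continuous_on (K n) v"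
    and "closed C"
  shows "u ` ((\<Union>n. K n) \<inter> v -` C) \<in> sets borel"
proof -
  have "compact (K n \<inter> v -` C)" for n
    using assms(1)[of n] continuous_closed_preimage[OF assms(3) compact_imp_closed assms(4)]
    by (metis Int_left_absorb compact_Int_closed)
  then have "compact (u ` (K n \<inter> v -` C))" for n
    using continuous_on_subset[OF assms(2) Int_lower1] by (rule compact_continuous_image[rotated])
  then have "(\<Union>n. u ` (K n \<inter> v -` C)) \<in> sets borel"
    by (intro sets.countable_UN) (auto intro: borel_compact)
  moreover have "u ` ((\<Union>n. K n) \<inter> v -` C) = (\<Union>n. u ` (K n \<inter> v -` C))" by auto
  ultimately show ?thesis by simp
qed

text \<open>A substitute for the Lusin--Souslin theorem on measurable images.\<close>

lemma factor_through:
  fixes M :: "'a::{second_countable_topology, complete_space} measure"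
    and u :: "'a \<Rightarrow> 'b::{second_countable_topology, complete_space}"
    and v :: "'a \<Rightarrow> 'c::{second_countable_topology, complete_space}"
  assumes "finite_measure M" and sets_M: "sets M = sets borel"
    and [measurable]: "u \<in> borel_measurable borel" "v \<in> borel_measurable borel"
    and D: "D \<in> sets borel"
    and det: "\<And>x y. x \<in> D \<Longrightarrow> y \<in> D \<Longrightarrow> u x = u y \<Longrightarrow> v x = v y"
  obtains D' h where "D' \<in> sets borel" "D' \<subseteq> D" "AE x in M. x \<in> D \<longrightarrow> x \<in> D'" "u ` D' \<in> sets borel"
    "h \<in> borel_measurable borel" "\<And>x. x \<in> D' \<Longrightarrow> h (u x) = v x"
proof -
  have uv: "(\<lambda>x. (u x, v x)) \<in> borel_measurable borel"
    unfolding borel_prod[symmetric] by measurable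
  obtain K where K: "\<And>n::nat. compact (K n)" "\<And>n. continuous_on (K n) (\<lambda>x. (u x, v x))"
    "(\<Union>n. K n) \<subseteq> D" "AE x in M. x \<in> D \<longrightarrow> x \<in> (\<Union>n. K n)"
    using Lusin_compact_exhaustion[OF assms(1,2) uv D] by blast
  define D' where "D' = (\<Union>n. K n)"
  have D': "D' \<in> sets borel" "D' \<subseteq> D" "AE x in M. x \<in> D \<longrightarrow> x \<in> D'"
    using K unfolding D'_def by (auto intro: sets.countable_UN borel_compact)
  have cont: "continuous_on (K n) u" "continuous_on (K n) v" for n
    using continuous_on_fst[OF K(2)] continuous_on_snd[OF K(2)] by simp_all
  have image_borel: "u ` (D' \<inter> v -` C) \<in> sets borel" if "closed C" for C
    unfolding D'_def using image_preimage_borel[OF K(1) cont that] .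
  have uD': "u ` D' \<in> sets borel" using image_borel[of UNIV] by simp
  define g where "g c = v (inv_into D' u c)" for c
  have g: "g (u x) = v x" if "x \<in> D'" for x
    unfolding g_def using that D'(2) by (intro det) (auto simp: inv_into_into f_inv_into_f)
  have "g \<in> borel_measurable (restrict_space borel (u ` D'))"
  proof (rule borel_measurableI_closed)
    fix C :: "'c set" assume "closed C"
    moreover have "g -` C \<inter> u ` D' = u ` (D' \<inter> v -` C)" using g by auto
    ultimately show "g -` C \<inter> space (restrict_space borel (u ` D')) \<in>
        sets (restrict_space borel (u ` D'))"
      using image_borel uD' by (auto simp: space_restrict_space sets_restrict_space_iff)
  qed
  then have "(\<lambda>c. if c \<in> u ` D' then g c else undefined) \<in> borel_measurable borel"
    using uD' by (subst (asm) measurable_restrict_space_iff) auto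
  then show ?thesis using that[OF D' uD'] g by simp
qed

lemma sets_completion_diff_null:
  assumes "A \<in> sets (completion M)"
  obtains N where "N \<in> null_sets M" "A - N \<in> sets M"
proof -
  obtain S N N' where "A = S \<union> N" "N \<subseteq> N'" "N' \<in> null_sets M" "S \<in> sets M"
    using assms by (rule sets_completionE)
  moreover from this have "A - N' = S - N'" by blast
  ultimately show ?thesis using that[of N'] by auto
qed

lemma mu_measurable_on_borel_version:
  fixes f :: "'a::topological_space \<Rightarrow> 'b::second_countable_topology"
  assumes sets_\<mu>: "sets \<mu> = sets borel" and f: "mu_measurable_on \<mu> S f"
  obtains S' f' where "S' \<in> sets borel" "S' \<subseteq> S" "S - S' \<in> null_sets (completion \<mu>)"
    "f' \<in> borel_measurable borel" "\<And>x. x \<in> S' \<Longrightarrow> f' x = f x"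
proof -
  obtain \<B> :: "'b set set" where \<B>: "countable \<B>" "topological_basis \<B>"
    using ex_countable_basis by blast
  have "\<exists>N. N \<in> null_sets \<mu> \<and> (f -` b \<inter> S) - N \<in> sets \<mu>" if "b \<in> insert UNIV \<B>" for b
  proof -
    have "b \<in> sets borel" using that topological_basis_open[OF \<B>(2)] by auto
    then have "f -` b \<inter> S \<in> sets (completion \<mu>)" using f unfolding mu_measurable_on_def by blast
    then show ?thesis by (rule sets_completion_diff_null) blast
  qed
  then obtain N where N: "\<And>b. b \<in> insert UNIV \<B> \<Longrightarrow> N b \<in> null_sets \<mu> \<and> (f -` b \<inter> S) - N b \<in> sets \<mu>"
    by metis
  define Z where "Z = (\<Union>b\<in>insert UNIV \<B>. N b)"
  have Z: "Z \<in> null_sets \<mu>"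
    unfolding Z_def using \<B>(1) N by (intro null_sets_UN') auto
  have preimage: "f -` b \<inter> (S - Z) \<in> sets borel" if "b \<in> insert UNIV \<B>" for b
  proof -
    have "f -` b \<inter> (S - Z) = ((f -` b \<inter> S) - N b) - Z" using that unfolding Z_def by blast
    then show ?thesis using N[OF that] Z sets_\<mu> by auto
  qed
  have S_Z: "S - Z \<in> sets borel" using preimage[of UNIV] by simp
  have "f \<in> borel_measurable (restrict_space borel (S - Z))"
  proof (rule borel_measurableI)
    fix U :: "'b set" assume "open U"
    then obtain \<U> where \<U>: "\<U> \<subseteq> \<B>" "U = \<Union>\<U>" using \<B>(2) unfolding topological_basis_def by metis
    then have "(\<Union>b\<in>\<U>. f -` b \<inter> (S - Z)) \<in> sets borel"
      using preimage countable_subset[OF \<U>(1) \<B>(1)] by (intro sets.countable_UN'') auto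
    then have "f -` U \<inter> (S - Z) \<in> sets borel"
      unfolding \<U>(2) by (simp add: vimage_Union Int_UN_distrib2)
    then show "f -` U \<inter> space (restrict_space borel (S - Z)) \<in> sets (restrict_space borel (S - Z))"
      using S_Z by (simp add: space_restrict_space sets_restrict_space_iff)
  qed
  then have "(\<lambda>x. if x \<in> S - Z then f x else undefined) \<in> borel_measurable borel"
    using S_Z by (subst (asm) measurable_restrict_space_iff) auto
  moreover have "S - (S - Z) \<in> null_sets (completion \<mu>)"
    by (rule null_sets_completion_subset[OF _ null_sets_completionI[OF Z]]) auto
  ultimately show ?thesis using that[OF S_Z] by auto
qed

lemma AE_not_in_if_compact_projections_null:
  fixes \<pi> :: "('a::polish_space \<times> 'b::polish_space) measure"
  assumes "finite_measure \<pi>" and sets_\<pi>: "sets \<pi> = sets borel" and D: "D \<in> sets borel"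
    and null: "\<And>K. compact K \<Longrightarrow> K \<subseteq> D \<Longrightarrow> emeasure (distr \<pi> borel fst) (fst ` K) = 0"
  shows "AE p in \<pi>. p \<notin> D"
proof -
  obtain K :: "nat \<Rightarrow> ('a \<times> 'b) set" where K: "\<And>n. compact (K n)" "(\<Union>n. K n) \<subseteq> D"
    "AE p in \<pi>. p \<in> D \<longrightarrow> p \<in> (\<Union>n. K n)"
    using inner_compact_exhaustion[OF assms(1) sets_\<pi> D] by blast
  have fst: "fst \<in> \<pi> \<rightarrow>\<^sub>M borel"
    unfolding measurable_cong_sets[OF sets_\<pi> refl] borel_prod[symmetric] by measurable
  have "AE p in \<pi>. fst p \<notin> fst ` K n" for n
  proof -
    have "fst ` K n \<in> sets borel"
      using K(1) by (intro borel_compact compact_continuous_image continuous_intros)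
    moreover have "emeasure (distr \<pi> borel fst) (fst ` K n) = 0"
      using null K(1,2) by blast
    ultimately have "AE x in distr \<pi> borel fst. x \<notin> fst ` K n"
      by (intro AE_not_in null_setsI) auto
    then show ?thesis by (rule AE_distrD[OF fst])
  qed
  then have "AE p in \<pi>. \<forall>n. fst p \<notin> fst ` K n" by (simp add: AE_all_countable)
  with K(3) show ?thesis by eventually_elim blast
qed

text \<open>Slicing: \<open>F - S\<close> is the length of the set of u with \<open>S \<le> u < F\<close>.\<close>

lemma nn_integral_diff_eq_lborel:
  fixes S F :: "'a \<Rightarrow> real"
  assumes "finite_measure N" and [measurable]: "S \<in> borel_measurable N" "F \<in> borel_measurable N"
    and le: "\<And>x. S x \<le> F x"
  shows "(\<integral>\<^sup>+x. ennreal (F x - S x) \<partial>N) =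
    (\<integral>\<^sup>+u. emeasure N {x \<in> space N. S x \<le> u} - emeasure N {x \<in> space N. F x \<le> u} \<partial>lborel)"
proof -
  interpret finite_measure N by fact
  interpret P: pair_sigma_finite lborel N ..
  have slice: "(\<integral>\<^sup>+x. indicator {S x..<F x} u \<partial>N) =
      emeasure N {x \<in> space N. S x \<le> u} - emeasure N {x \<in> space N. F x \<le> u}" for u
  proof -
    have "(\<integral>\<^sup>+x. indicator {S x..<F x} u \<partial>N) =
        (\<integral>\<^sup>+x. indicator ({x \<in> space N. S x \<le> u} - {x \<in> space N. F x \<le> u}) x \<partial>N)"
      by (intro nn_integral_cong) (auto simp: indicator_def)
    also have "\<dots> = emeasure N ({x \<in> space N. S x \<le> u} - {x \<in> space N. F x \<le> u})"
      by (intro nn_integral_indicator) measurable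
    also have "\<dots> = emeasure N {x \<in> space N. S x \<le> u} - emeasure N {x \<in> space N. F x \<le> u}"
      using le by (intro emeasure_Diff) (auto intro: order.trans)
    finally show ?thesis .
  qed
  have "(\<integral>\<^sup>+x. ennreal (F x - S x) \<partial>N) = (\<integral>\<^sup>+x. (\<integral>\<^sup>+u. indicator {S x..<F x} u \<partial>lborel) \<partial>N)"
    using le by (intro nn_integral_cong) simp
  also have "\<dots> = (\<integral>\<^sup>+u. (\<integral>\<^sup>+x. indicator {S x..<F x} u \<partial>N) \<partial>lborel)"
  proof (rule P.Fubini')
    have "(\<lambda>p. if S (snd p) \<le> fst p \<and> fst p < F (snd p) then 1 else 0 :: ennreal)
      \<in> borel_measurable (borel \<Otimes>\<^sub>M N)"
      by measurable
    also have "(\<lambda>p. if S (snd p) \<le> fst p \<and> fst p < F (snd p) then 1 else 0 :: ennreal) =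
      (\<lambda>(u, x). indicator {S x..<F x} u)"
      by (auto simp: fun_eq_iff)
    finally show "(\<lambda>(u, x). indicator {S x..<F x} u :: ennreal) \<in> borel_measurable (lborel \<Otimes>\<^sub>M N)"
      by (simp cong: measurable_cong_sets)
  qed
  also have "\<dots> =
      (\<integral>\<^sup>+u. emeasure N {x \<in> space N. S x \<le> u} - emeasure N {x \<in> space N. F x \<le> u} \<partial>lborel)"
    by (intro nn_integral_cong slice)
  finally show ?thesis .
qed

lemma nn_integral_diff_cong_distr:
  fixes S E E' :: "'a \<Rightarrow> real"
  assumes "finite_measure N" and [measurable]: "S \<in> borel_measurable N"
    "E \<in> borel_measurable N" "E' \<in> borel_measurable N"
    and "\<And>x. S x \<le> E x" "\<And>x. S x \<le> E' x" and distr: "distr N borel E = distr N borel E'"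
  shows "(\<integral>\<^sup>+x. ennreal (E x - S x) \<partial>N) = (\<integral>\<^sup>+x. ennreal (E' x - S x) \<partial>N)"
proof -
  have "emeasure N {x \<in> space N. F x \<le> u} = emeasure (distr N borel F) {..u}"
    if "F \<in> borel_measurable N" for F and u :: real
    using that by (subst emeasure_distr) (auto intro: arg_cong[where f="emeasure N"])
  then show ?thesis
    using nn_integral_diff_eq_lborel[OF assms(1,2)] assms(3-7) by simp
qed

section \<open>Rearrangement along the fibres\<close>

locale fibred_measure = finite_measure N for N :: "'w measure" +
  fixes q :: "'w \<Rightarrow> 'x::topological_space"
  assumes q [measurable]: "q \<in> borel_measurable N"
begin

definition law_on :: "('w \<Rightarrow> bool) \<Rightarrow> 'x measure" where
  "law_on Z = distr (density N (indicator {w \<in> space N. Z w})) borel q"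

lemma sets_law_on [simp]: "sets (law_on Z) = sets borel"
  unfolding law_on_def by simp

lemma emeasure_law_on:
  assumes [measurable]: "Measurable.pred N Z" "B \<in> sets borel"
  shows "emeasure (law_on Z) B = emeasure N {w \<in> space N. q w \<in> B \<and> Z w}"
proof -
  have "emeasure (law_on Z) B =
      emeasure (density N (indicator {w \<in> space N. Z w})) (q -` B \<inter> space N)"
    unfolding law_on_def by (subst emeasure_distr) auto
  also have "\<dots> = emeasure N ({w \<in> space N. Z w} \<inter> (q -` B \<inter> space N))"
    by (intro emeasure_restricted) auto
  also have "{w \<in> space N. Z w} \<inter> (q -` B \<inter> space N) = {w \<in> space N. q w \<in> B \<and> Z w}" by auto
  finally show ?thesis .
qed

lemma finite_measure_law_on:
  assumes "Measurable.pred N Z"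
  shows "finite_measure (law_on Z)"
proof (rule finite_measureI)
  have "space (law_on Z) = UNIV" unfolding law_on_def by simp
  then show "emeasure (law_on Z) (space (law_on Z)) \<noteq> \<infinity>"
    using emeasure_law_on[OF assms, of UNIV] by (simp add: emeasure_finite)
qed

lemma law_on_le_iff:
  "law_on Y \<le> law_on Z \<longleftrightarrow> (\<forall>B\<in>sets borel. emeasure (law_on Y) B \<le> emeasure (law_on Z) B)"
  by (subst le_measure) simp_all

lemma law_on_mono_AE:
  assumes [measurable]: "Measurable.pred N Y" "Measurable.pred N Z"
    and imp: "AE w in N. Y w \<longrightarrow> Z w"
  shows "law_on Y \<le> law_on Z"
  unfolding law_on_le_iff
proof
  fix B assume [measurable]: "B \<in> sets (borel :: 'x measure)"
  have "emeasure N {w \<in> space N. q w \<in> B \<and> Y w} \<le> emeasure N {w \<in> space N. q w \<in> B \<and> Z w}"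
    by (rule emeasure_mono_AE) (use imp in auto)
  then show "emeasure (law_on Y) B \<le> emeasure (law_on Z) B" by (simp add: emeasure_law_on)
qed

lemma emeasure_law_on_if:
  assumes [measurable]: "B \<in> sets borel" "C \<in> sets borel" "Measurable.pred N Y"
    "Measurable.pred N Z"
  shows "emeasure (law_on (\<lambda>w. if q w \<in> C then Y w else Z w)) B =
    emeasure (law_on Y) (B \<inter> C) + emeasure (law_on Z) (B - C)"
proof -
  have "{w \<in> space N. q w \<in> B \<and> (if q w \<in> C then Y w else Z w)} =
    {w \<in> space N. q w \<in> B \<inter> C \<and> Y w} \<union> {w \<in> space N. q w \<in> B - C \<and> Z w}" by auto
  then have "emeasure (law_on (\<lambda>w. if q w \<in> C then Y w else Z w)) B =
      emeasure N {w \<in> space N. q w \<in> B \<inter> C \<and> Y w} + emeasure N {w \<in> space N. q w \<in> B - C \<and> Z w}"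
    by (subst emeasure_law_on, measurable, simp only:) (intro plus_emeasure[symmetric], auto)
  also have "\<dots> = emeasure (law_on Y) (B \<inter> C) + emeasure (law_on Z) (B - C)"
    by (simp only: emeasure_law_on[OF assms(3)] emeasure_law_on[OF assms(4)] sets.Int sets.Diff
        assms(1,2))
  finally show ?thesis .
qed

lemma law_on_if_mono:
  assumes [measurable]: "Measurable.pred N Y" "Measurable.pred N Y'" "Measurable.pred N Z"
    "Measurable.pred N Z'" "C \<in> sets borel"
    and le: "law_on Y \<le> law_on Z" "law_on Y' \<le> law_on Z'"
  shows "law_on (\<lambda>w. if q w \<in> C then Y w else Y' w) \<le> law_on (\<lambda>w. if q w \<in> C then Z w else Z' w)"
  using le unfolding law_on_le_iff by (auto simp: emeasure_law_on_if intro!: add_mono)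

lemma law_on_inter_le:
  assumes [measurable]: "C \<in> sets borel" "Measurable.pred N Y"
    and le: "\<And>B. B \<in> sets borel \<Longrightarrow> B \<subseteq> C \<Longrightarrow> emeasure (law_on Y) B \<le> emeasure (law_on Z) B"
  shows "law_on (\<lambda>w. q w \<in> C \<and> Y w) \<le> law_on Z"
  unfolding law_on_le_iff
proof
  fix B assume [measurable]: "B \<in> sets (borel :: 'x measure)"
  have "{w \<in> space N. q w \<in> B \<and> q w \<in> C \<and> Y w} = {w \<in> space N. q w \<in> B \<inter> C \<and> Y w}" by auto
  then have "emeasure (law_on (\<lambda>w. q w \<in> C \<and> Y w)) B = emeasure (law_on Y) (B \<inter> C)"
    by (subst (1 2) emeasure_law_on) simp_all
  also have "\<dots> \<le> emeasure (law_on Z) (B \<inter> C)" by (rule le) auto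
  also have "\<dots> \<le> emeasure (law_on Z) B" by (rule emeasure_mono) auto
  finally show "emeasure (law_on (\<lambda>w. q w \<in> C \<and> Y w)) B \<le> emeasure (law_on Z) B" .
qed

lemma emeasure_law_on_not:
  assumes [measurable]: "Measurable.pred N Z" "B \<in> sets borel"
  shows "emeasure (law_on (\<lambda>w. \<not> Z w)) B = emeasure (law_on (\<lambda>_. True)) B - emeasure (law_on Z) B"
proof -
  have "{w \<in> space N. q w \<in> B \<and> \<not> Z w} =
    {w \<in> space N. q w \<in> B \<and> True} - {w \<in> space N. q w \<in> B \<and> Z w}" by auto
  then have "emeasure N {w \<in> space N. q w \<in> B \<and> \<not> Z w} =
      emeasure N {w \<in> space N. q w \<in> B \<and> True} - emeasure N {w \<in> space N. q w \<in> B \<and> Z w}"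
    by (simp only:) (intro emeasure_Diff, auto)
  then show ?thesis
    using emeasure_law_on[of "\<lambda>_. True" B] emeasure_law_on[of Z B] emeasure_law_on[of "\<lambda>w. \<not> Z w" B]
    by simp
qed

lemma law_on_not_mono:
  assumes "Measurable.pred N Y" "Measurable.pred N Z" "law_on Y \<le> law_on Z"
  shows "law_on (\<lambda>w. \<not> Z w) \<le> law_on (\<lambda>w. \<not> Y w)"
  using assms(3) unfolding law_on_le_iff
  by (simp add: emeasure_law_on_not[OF assms(1)] emeasure_law_on_not[OF assms(2)]
      ennreal_minus_mono)

lemma law_on_Hahn_decomposition:
  assumes [measurable]: "Measurable.pred N Y" "Measurable.pred N Z"
  obtains P where "P \<in> sets borel" "law_on (\<lambda>w. q w \<notin> P \<and> Y w) \<le> law_on Z"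
    "law_on (\<lambda>w. q w \<in> P \<and> \<not> Y w) \<le> law_on (\<lambda>w. \<not> Z w)"
proof -
  obtain P where P [measurable]: "P \<in> sets borel"
    and on_P: "\<And>B. B \<in> sets borel \<Longrightarrow> B \<subseteq> P \<Longrightarrow> emeasure (law_on Z) B \<le> emeasure (law_on Y) B"
    and off_P: "\<And>B. B \<in> sets borel \<Longrightarrow> B \<inter> P = {} \<Longrightarrow> emeasure (law_on Y) B \<le> emeasure (law_on Z) B"
    using finite_unsigned_Hahn_decomposition[of "law_on Y" "law_on Z"] assms
    by (auto simp: finite_measure_law_on)
  have "law_on (\<lambda>w. q w \<in> - P \<and> Y w) \<le> law_on Z"
    by (rule law_on_inter_le) (auto intro: off_P borel_comp)
  moreover have "law_on (\<lambda>w. q w \<in> P \<and> \<not> Y w) \<le> law_on (\<lambda>w. \<not> Z w)"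
    by (rule law_on_inter_le) (auto simp: emeasure_law_on_not intro: on_P ennreal_minus_mono)
  ultimately show ?thesis using that[OF P] by simp
qed

lemma rational_Hahn_sets_exist:
  fixes X :: "'w \<Rightarrow> real"
  assumes [measurable]: "X \<in> borel_measurable N" "Measurable.pred N Z"
  obtains P where "\<And>r. P r \<in> sets borel"
    "\<And>r. law_on (\<lambda>w. q w \<notin> P r \<and> X w \<le> real_of_rat r) \<le> law_on Z"
    "\<And>r. law_on (\<lambda>w. q w \<in> P r \<and> \<not> X w \<le> real_of_rat r) \<le> law_on (\<lambda>w. \<not> Z w)"
proof -
  let ?hahn = "\<lambda>r P. P \<in> sets borel \<and>
    law_on (\<lambda>w. q w \<notin> P \<and> X w \<le> real_of_rat r) \<le> law_on Z \<and>
    law_on (\<lambda>w. q w \<in> P \<and> \<not> X w \<le> real_of_rat r) \<le> law_on (\<lambda>w. \<not> Z w)"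
  have "\<exists>P. ?hahn r P" for r
    by (rule law_on_Hahn_decomposition[of "\<lambda>w. X w \<le> real_of_rat r" Z]) auto
  then obtain P where "\<forall>r. ?hahn r (P r)" using choice[of ?hahn] by blast
  then show ?thesis using that by blast
qed

lemma law_on_Ex_le:
  assumes [measurable]: "\<And>n::nat. Measurable.pred N (Y n)" "Measurable.pred N Z"
    and le: "\<And>n. law_on (\<lambda>w. \<exists>i<n. Y i w) \<le> law_on Z"
  shows "law_on (\<lambda>w. \<exists>i. Y i w) \<le> law_on Z"
  unfolding law_on_le_iff
proof
  fix B assume [measurable]: "B \<in> sets (borel :: 'x measure)"
  let ?U = "\<lambda>n. {w \<in> space N. q w \<in> B \<and> (\<exists>i<n. Y i w)}"
  have "{w \<in> space N. q w \<in> B \<and> (\<exists>i. Y i w)} = (\<Union>n. ?U n)" by auto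
  then have "emeasure (law_on (\<lambda>w. \<exists>i. Y i w)) B = emeasure N (\<Union>n. ?U n)"
    by (simp add: emeasure_law_on)
  also have "\<dots> = (SUP n. emeasure N (?U n))"
    by (rule SUP_emeasure_incseq[symmetric]) (auto simp: incseq_def intro: less_le_trans)
  also have "\<dots> = (SUP n. emeasure (law_on (\<lambda>w. \<exists>i<n. Y i w)) B)"
    by (simp add: emeasure_law_on)
  also have "\<dots> \<le> emeasure (law_on Z) B"
    using le by (intro SUP_least) (simp add: law_on_le_iff)
  finally show "emeasure (law_on (\<lambda>w. \<exists>i. Y i w)) B \<le> emeasure (law_on Z) B" .
qed

lemma law_on_Ex_threshold_seq_le:
  fixes g :: "nat \<Rightarrow> 'x \<Rightarrow> ereal" and X :: "'w \<Rightarrow> real"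
  assumes [measurable]: "\<And>i. g i \<in> borel_measurable borel" "X \<in> borel_measurable N"
    "Measurable.pred N Z"
    and le: "\<And>i. law_on (\<lambda>w. X w \<le> g i (q w)) \<le> law_on Z"
  shows "law_on (\<lambda>w. \<exists>i. X w \<le> g i (q w)) \<le> law_on Z"
proof -
  have "law_on (\<lambda>w. \<exists>i<n. X w \<le> g i (q w)) \<le> law_on Z" for n
  proof (induction n)
    case 0
    show ?case by (rule law_on_mono_AE) auto
  next
    case (Suc n)
    define C where "C = {x. \<forall>i<n. g i x \<le> g n x}"
    have [measurable]: "C \<in> sets borel" unfolding C_def by measurable
    have split: "(\<exists>i<Suc n. s \<le> g i x) \<longleftrightarrow> (if x \<in> C then s \<le> g n x else \<exists>i<n. s \<le> g i x)" for s x
      unfolding C_def by (auto simp: less_Suc_eq not_le intro: order.trans less_imp_le)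
    have "law_on (\<lambda>w. if q w \<in> C then X w \<le> g n (q w) else \<exists>i<n. X w \<le> g i (q w)) \<le>
        law_on (\<lambda>w. if q w \<in> C then Z w else Z w)"
      by (intro law_on_if_mono le Suc.IH) measurable
    then show ?case unfolding split if_cancel .
  qed
  then show ?thesis by (rule law_on_Ex_le[rotated 2]) measurable
qed

lemma law_on_Ex_threshold_le:
  fixes g :: "'i::countable \<Rightarrow> 'x \<Rightarrow> ereal" and X :: "'w \<Rightarrow> real"
  assumes [measurable]: "\<And>i. g i \<in> borel_measurable borel" "X \<in> borel_measurable N"
    "Measurable.pred N Z"
    and le: "\<And>i. i \<in> I \<Longrightarrow> law_on (\<lambda>w. X w \<le> g i (q w)) \<le> law_on Z"
  shows "law_on (\<lambda>w. \<exists>i\<in>I. X w \<le> g i (q w)) \<le> law_on Z"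
proof -
  define k where "k n x = (if from_nat n \<in> I then g (from_nat n) x else -\<infinity>)" for n x
  have "law_on (\<lambda>w. X w \<le> k n (q w)) \<le> law_on Z" for n
  proof (cases "from_nat n \<in> I")
    case True
    then show ?thesis using le unfolding k_def by simp
  next
    case False
    then show ?thesis unfolding k_def by (intro law_on_mono_AE) auto
  qed
  moreover have "k n \<in> borel_measurable borel" for n unfolding k_def by measurable
  ultimately have "law_on (\<lambda>w. \<exists>n. X w \<le> k n (q w)) \<le> law_on Z"
    by (intro law_on_Ex_threshold_seq_le assms(2,3))
  moreover have "(\<exists>n. ereal s \<le> k n x) \<longleftrightarrow> (\<exists>i\<in>I. ereal s \<le> g i x)" for s x
  proof
    assume "\<exists>n. ereal s \<le> k n x"
    then show "\<exists>i\<in>I. ereal s \<le> g i x" unfolding k_def by (auto split: if_splits)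
  next
    assume "\<exists>i\<in>I. ereal s \<le> g i x"
    then obtain i where "i \<in> I" "ereal s \<le> g i x" ..
    then show "\<exists>n. ereal s \<le> k n x" unfolding k_def by (intro exI[of _ "to_nat i"]) simp
  qed
  ultimately show ?thesis by simp
qed

lemma distr_Pair_eqI:
  fixes a b :: "'w \<Rightarrow> real"
  assumes [measurable]: "a \<in> borel_measurable N" "b \<in> borel_measurable N"
    and eq: "\<And>e. law_on (\<lambda>w. a w < e) = law_on (\<lambda>w. b w < e)"
  shows "distr N (borel \<Otimes>\<^sub>M borel) (\<lambda>w. (q w, a w)) = distr N (borel \<Otimes>\<^sub>M borel) (\<lambda>w. (q w, b w))"
proof -
  let ?E = "{B \<times> C |B C. B \<in> sets (borel :: 'x measure) \<and> C \<in> range (lessThan :: real \<Rightarrow> real set)}"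
  have emeasure_rect: "emeasure (distr N (borel \<Otimes>\<^sub>M borel) (\<lambda>w. (q w, c w))) (B \<times> {..<e}) =
      emeasure (law_on (\<lambda>w. c w < e)) B"
    if [measurable]: "c \<in> borel_measurable N" "B \<in> sets borel" for c :: "'w \<Rightarrow> real" and B e
    by (subst emeasure_distr, simp_all add: emeasure_law_on)
      (auto intro: arg_cong[where f="emeasure N"])
  show ?thesis
  proof (rule measure_eqI_generator_eq[where E="?E" and \<Omega>=UNIV and A="\<lambda>n::nat. UNIV \<times> {..<real n}"])
    show "Int_stable ?E"
    proof (rule Int_stableI)
      fix X Y assume "X \<in> ?E" "Y \<in> ?E"
      then obtain B B' e e' where "X = B \<times> {..<e}" "Y = B' \<times> {..<e'}" "B \<in> sets borel"
        "B' \<in> sets borel"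
        by auto
      then have "X \<inter> Y = (B \<inter> B') \<times> {..<min e e'}" "B \<inter> B' \<in> sets borel" by auto
      then show "X \<inter> Y \<in> ?E" by blast
    qed
    fix X assume "X \<in> ?E"
    then obtain B e where "X = B \<times> {..<e}" "B \<in> sets borel" by auto
    then show "emeasure (distr N (borel \<Otimes>\<^sub>M borel) (\<lambda>w. (q w, a w))) X =
        emeasure (distr N (borel \<Otimes>\<^sub>M borel) (\<lambda>w. (q w, b w))) X"
      by (simp only: emeasure_rect assms(1,2) eq)
  next
    show "range (\<lambda>n::nat. UNIV \<times> {..<real n}) \<subseteq> ?E"
      by (rule image_subsetI, rule CollectI, intro exI conjI, rule refl) auto
    show "(\<Union>n::nat. UNIV \<times> {..<real n}) = (UNIV :: ('x \<times> real) set)"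
      by (auto intro: reals_Archimedean2)
    have "finite_measure (distr N (borel \<Otimes>\<^sub>M borel) (\<lambda>w. (q w, a w)))"
      by (rule finite_measure_distr) measurable
    then show "emeasure (distr N (borel \<Otimes>\<^sub>M borel) (\<lambda>w. (q w, a w))) (UNIV \<times> {..<real n}) \<noteq> \<infinity>" for n
      by (simp add: finite_measure.emeasure_finite)
  qed (simp_all add: sets_borel_prod_lessThan)
qed

end

locale diffuse_fibred_variable = fibred_measure N q
  for N :: "'w measure" and q :: "'w \<Rightarrow> 'x::topological_space" +
  fixes S :: "'w \<Rightarrow> real"
  assumes S [measurable]: "S \<in> borel_measurable N"
    and diffuse: "\<And>\<sigma> :: 'x \<Rightarrow> ereal. \<sigma> \<in> borel_measurable borel \<Longrightarrow> AE w in N. ereal (S w) \<noteq> \<sigma> (q w)"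
begin

definition threshold :: "(rat \<Rightarrow> 'x set) \<Rightarrow> 'x \<Rightarrow> ereal" where
  "threshold P x = (SUP r. if x \<in> P r then -\<infinity> else ereal (real_of_rat r))"

lemma borel_measurable_threshold [measurable]:
  assumes [measurable]: "\<And>r. P r \<in> sets borel"
  shows "threshold P \<in> borel_measurable borel"
  unfolding threshold_def by measurable

lemma law_on_le_threshold:
  assumes P [measurable]: "\<And>r. P r \<in> sets borel" and Z [measurable]: "Measurable.pred N Z"
    and below: "\<And>r. law_on (\<lambda>w. q w \<notin> P r \<and> S w \<le> real_of_rat r) \<le> law_on Z"
  shows "law_on (\<lambda>w. S w \<le> threshold P (q w)) \<le> law_on Z"
proof -
  define g :: "rat \<Rightarrow> 'x \<Rightarrow> ereal" where "g r x = (if x \<in> P r then -\<infinity> else real_of_rat r)" for r x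
  have [measurable]: "g r \<in> borel_measurable borel" for r unfolding g_def by measurable
  have threshold_eq: "threshold P x = (SUP r. g r x)" for x unfolding threshold_def g_def ..
  have "law_on (\<lambda>w. S w \<le> g r (q w)) \<le> law_on Z" for r
  proof -
    have "ereal (S w) \<le> g r (q w) \<longleftrightarrow> q w \<notin> P r \<and> S w \<le> real_of_rat r" for w
      unfolding g_def by auto
    with below show ?thesis by simp
  qed
  then have "law_on (\<lambda>w. \<exists>r\<in>UNIV. S w \<le> g r (q w)) \<le> law_on Z"
    by (intro law_on_Ex_threshold_le) auto
  moreover have "law_on (\<lambda>w. S w \<le> threshold P (q w)) \<le> law_on (\<lambda>w. \<exists>r\<in>UNIV. S w \<le> g r (q w))"
  proof (rule law_on_mono_AE)
    show "AE w in N. S w \<le> threshold P (q w) \<longrightarrow> (\<exists>r\<in>UNIV. S w \<le> g r (q w))"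
      using diffuse[OF borel_measurable_threshold[of P, OF P]] unfolding threshold_eq
      by eventually_elim (auto simp: le_less less_SUP_iff)
  qed measurable
  ultimately show ?thesis by (rule order.trans[rotated])
qed

lemma law_on_not_le_threshold:
  assumes P [measurable]: "\<And>r. P r \<in> sets borel" and Z [measurable]: "Measurable.pred N Z"
    and above: "\<And>r. law_on (\<lambda>w. q w \<in> P r \<and> \<not> S w \<le> real_of_rat r) \<le> law_on Z"
  shows "law_on (\<lambda>w. \<not> S w \<le> threshold P (q w)) \<le> law_on Z"
proof -
  define h :: "rat \<Rightarrow> 'x \<Rightarrow> ereal" where "h r x = (if x \<in> P r then - real_of_rat r else -\<infinity>)" for r x
  have [measurable]: "h r \<in> borel_measurable borel" for r unfolding h_def by measurable
  have "law_on (\<lambda>w. - S w \<le> h r (q w)) \<le> law_on Z" for r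
  proof -
    have "AE w in N. ereal (S w) \<noteq> ereal (real_of_rat r)" by (rule diffuse) simp
    then have "AE w in N. - S w \<le> h r (q w) \<longrightarrow> q w \<in> P r \<and> \<not> S w \<le> real_of_rat r"
      by eventually_elim (auto simp: h_def)
    then have "law_on (\<lambda>w. - S w \<le> h r (q w)) \<le> law_on (\<lambda>w. q w \<in> P r \<and> \<not> S w \<le> real_of_rat r)"
      by (intro law_on_mono_AE) auto
    with above show ?thesis by (rule order.trans[rotated])
  qed
  then have "law_on (\<lambda>w. \<exists>r\<in>UNIV. - S w \<le> h r (q w)) \<le> law_on Z"
    by (intro law_on_Ex_threshold_le) auto
  moreover have "\<exists>r\<in>UNIV. - s \<le> h r x" if s: "\<not> ereal s \<le> threshold P x" for s x
  proof -
    obtain r where r: "threshold P x < real_of_rat r" "real_of_rat r < s"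
      using ereal_dense3[of "threshold P x" s] s by (auto simp: not_le)
    have "(if x \<in> P r then -\<infinity> else ereal (real_of_rat r)) \<le> threshold P x"
      unfolding threshold_def by (rule SUP_upper) simp
    with r(1) have "x \<in> P r" by (auto split: if_splits)
    then show ?thesis using r(2) unfolding h_def by (intro bexI[of _ r]) auto
  qed
  then have "law_on (\<lambda>w. \<not> S w \<le> threshold P (q w)) \<le> law_on (\<lambda>w. \<exists>r\<in>UNIV. - S w \<le> h r (q w))"
    by (intro law_on_mono_AE) auto
  ultimately show ?thesis by (rule order.trans[rotated])
qed

text \<open>The threshold at x is the supremum of those rationals r below which, according to a Hahn
  decomposition, S carries less mass near x than the event Z. No disintegration is needed.\<close>

lemma quantile_exists:
  assumes Z [measurable]: "Measurable.pred N Z"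
  obtains \<sigma> :: "'x \<Rightarrow> ereal" where "\<sigma> \<in> borel_measurable borel"
    "law_on (\<lambda>w. S w \<le> \<sigma> (q w)) = law_on Z"
proof -
  obtain P where [measurable]: "\<And>r. P r \<in> sets borel"
    and below: "\<And>r. law_on (\<lambda>w. q w \<notin> P r \<and> S w \<le> real_of_rat r) \<le> law_on Z"
    and above: "\<And>r. law_on (\<lambda>w. q w \<in> P r \<and> \<not> S w \<le> real_of_rat r) \<le> law_on (\<lambda>w. \<not> Z w)"
    using rational_Hahn_sets_exist[OF S Z] by blast
  have "law_on (\<lambda>w. \<not> S w \<le> threshold P (q w)) \<le> law_on (\<lambda>w. \<not> Z w)"
    by (rule law_on_not_le_threshold[OF _ _ above]) measurable
  from law_on_not_mono[OF _ _ this] have "law_on Z \<le> law_on (\<lambda>w. S w \<le> threshold P (q w))" by simp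
  moreover have "law_on (\<lambda>w. S w \<le> threshold P (q w)) \<le> law_on Z"
    by (rule law_on_le_threshold[OF _ _ below]) measurable
  ultimately show ?thesis by (intro that[of "threshold P"]) (simp_all add: antisym)
qed

lemma bounded_quantile_exists:
  assumes [measurable]: "Measurable.pred N Z" and Z_le: "\<And>w. Z w \<Longrightarrow> S w \<le> c"
  obtains \<sigma> :: "'x \<Rightarrow> ereal" where "\<sigma> \<in> borel_measurable borel" "\<And>x. \<sigma> x \<le> c"
    "law_on (\<lambda>w. S w \<le> \<sigma> (q w)) = law_on Z"
proof -
  obtain \<sigma> :: "'x \<Rightarrow> ereal" where [measurable]: "\<sigma> \<in> borel_measurable borel"
    and \<sigma>: "law_on (\<lambda>w. S w \<le> \<sigma> (q w)) = law_on Z"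
    using quantile_exists[OF assms(1)] .
  define C where "C = {x. \<sigma> x \<le> ereal c}"
  have [measurable]: "C \<in> sets borel" unfolding C_def by measurable
  have "law_on Z = law_on (\<lambda>w. if q w \<in> C then Z w else Z w)" by simp
  also have "\<dots> \<le> law_on (\<lambda>w. if q w \<in> C then S w \<le> \<sigma> (q w) else S w \<le> c)"
  proof (rule law_on_if_mono)
    show "law_on Z \<le> law_on (\<lambda>w. S w \<le> \<sigma> (q w))" by (simp add: \<sigma>)
    show "law_on Z \<le> law_on (\<lambda>w. S w \<le> c)" using Z_le by (intro law_on_mono_AE) auto
  qed measurable
  also have "\<dots> = law_on (\<lambda>w. S w \<le> min (\<sigma> (q w)) c)"
    by (rule arg_cong[where f=law_on]) (simp add: fun_eq_iff C_def min_def)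
  finally have "law_on Z \<le> law_on (\<lambda>w. S w \<le> min (\<sigma> (q w)) c)" .
  moreover have "law_on (\<lambda>w. S w \<le> min (\<sigma> (q w)) c) \<le> law_on Z"
    unfolding \<sigma>[symmetric] by (intro law_on_mono_AE) auto
  ultimately show ?thesis using that[of "\<lambda>x. min (\<sigma> x) c"] by (simp add: antisym)
qed

lemma rational_quantiles_exist:
  fixes E :: "'w \<Rightarrow> real"
  assumes [measurable]: "E \<in> borel_measurable N" and SE: "\<And>w. S w \<le> E w"
  obtains \<rho> :: "rat \<Rightarrow> 'x \<Rightarrow> ereal" where "\<And>r. \<rho> r \<in> borel_measurable borel"
    "\<And>r x. \<rho> r x \<le> real_of_rat r"
    "\<And>r. law_on (\<lambda>w. S w \<le> \<rho> r (q w)) = law_on (\<lambda>w. E w \<le> real_of_rat r)"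
proof -
  let ?quantile = "\<lambda>r (\<rho> :: 'x \<Rightarrow> ereal). \<rho> \<in> borel_measurable borel \<and> (\<forall>x. \<rho> x \<le> real_of_rat r) \<and>
    law_on (\<lambda>w. S w \<le> \<rho> (q w)) = law_on (\<lambda>w. E w \<le> real_of_rat r)"
  have "\<exists>\<rho>. ?quantile r \<rho>" for r
    by (rule bounded_quantile_exists[of "\<lambda>w. E w \<le> real_of_rat r" "real_of_rat r"])
      (measurable, meson SE order.trans, blast)
  then obtain \<rho> where "\<forall>r. ?quantile r (\<rho> r)" using choice[of ?quantile] by blast
  then show ?thesis using that by blast
qed

lemma fibrewise_rearrangement_ereal:
  fixes E :: "'w \<Rightarrow> real"
  assumes [measurable]: "E \<in> borel_measurable N" and SE: "\<And>w. S w \<le> E w"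
  obtains t :: "'x \<times> real \<Rightarrow> ereal" where "t \<in> borel_measurable (borel \<Otimes>\<^sub>M borel)"
    "\<And>x s. s \<le> t (x, s)" "\<And>e::ereal. law_on (\<lambda>w. t (q w, S w) < e) = law_on (\<lambda>w. E w < e)"
proof -
  obtain \<rho> :: "rat \<Rightarrow> 'x \<Rightarrow> ereal" where [measurable]: "\<And>r. \<rho> r \<in> borel_measurable borel"
    and \<rho>_le: "\<And>r x. \<rho> r x \<le> real_of_rat r"
    and \<rho>: "\<And>r. law_on (\<lambda>w. S w \<le> \<rho> r (q w)) = law_on (\<lambda>w. E w \<le> real_of_rat r)"
    using rational_quantiles_exist[OF assms] by blast
  define t :: "'x \<times> real \<Rightarrow> ereal"
    where "t p = (INF r. if snd p \<le> \<rho> r (fst p) then ereal (real_of_rat r) else \<infinity>)" for p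
  have t [measurable]: "t \<in> borel_measurable (borel \<Otimes>\<^sub>M borel)" unfolding t_def by measurable
  have t_ge: "s \<le> t (x, s)" for x s
    unfolding t_def using order.trans[OF _ \<rho>_le, of "ereal s"] by (intro INF_greatest) auto
  have "law_on (\<lambda>w. t (q w, S w) < e) = law_on (\<lambda>w. E w < e)" for e :: ereal
  proof (rule antisym)
    define I where "I = {r. ereal (real_of_rat r) < e}"
    have t_less: "t (x, s) < e \<longleftrightarrow> (\<exists>r\<in>I. s \<le> \<rho> r x)" for x s
      unfolding t_def INF_less_iff I_def by (auto split: if_splits)
    have E_less: "E w < e \<longleftrightarrow> (\<exists>r\<in>I. E w \<le> ereal (real_of_rat r))" for w
      using ereal_dense3[of "E w" e] unfolding I_def
      by (auto intro: less_imp_le le_less_trans[of "ereal (E w)" "ereal (real_of_rat r)" e for r])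
    have "law_on (\<lambda>w. S w \<le> \<rho> r (q w)) \<le> law_on (\<lambda>w. E w < e)" if "r \<in> I" for r
      unfolding \<rho> using that by (intro law_on_mono_AE) (auto simp: E_less)
    then show "law_on (\<lambda>w. t (q w, S w) < e) \<le> law_on (\<lambda>w. E w < e)"
      unfolding t_less by (intro law_on_Ex_threshold_le) auto
    have "law_on (\<lambda>w. E w \<le> real_of_rat r) \<le> law_on (\<lambda>w. t (q w, S w) < e)" if "r \<in> I" for r
      unfolding \<rho>[symmetric] using that by (intro law_on_mono_AE) (auto simp: t_less)
    then show "law_on (\<lambda>w. E w < e) \<le> law_on (\<lambda>w. t (q w, S w) < e)"
      unfolding E_less by (intro law_on_Ex_threshold_le) auto
  qed
  then show ?thesis using that[OF t t_ge] by blast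
qed

lemma fibrewise_rearrangement:
  fixes E :: "'w \<Rightarrow> real"
  assumes E [measurable]: "E \<in> borel_measurable N" and SE: "\<And>w. S w \<le> E w"
  obtains \<tau> where "\<tau> \<in> borel_measurable (borel \<Otimes>\<^sub>M borel)" "\<And>x s. s \<le> \<tau> (x, s)"
    "distr N (borel \<Otimes>\<^sub>M borel) (\<lambda>w. (q w, \<tau> (q w, S w))) =
      distr N (borel \<Otimes>\<^sub>M borel) (\<lambda>w. (q w, E w))"
proof -
  obtain t :: "'x \<times> real \<Rightarrow> ereal" where [measurable]: "t \<in> borel_measurable (borel \<Otimes>\<^sub>M borel)"
    and t_ge: "\<And>x s. s \<le> t (x, s)"
    and t_law: "\<And>e::ereal. law_on (\<lambda>w. t (q w, S w) < e) = law_on (\<lambda>w. E w < e)"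
    using fibrewise_rearrangement_ereal[OF E SE] by blast
  have "emeasure N {w \<in> space N. t (q w, S w) < \<infinity>} = emeasure N (space N)"
    using arg_cong[OF t_law[of \<infinity>], of "\<lambda>L. emeasure L UNIV"] by (simp add: emeasure_law_on)
  then have "emeasure N (space N - {w \<in> space N. t (q w, S w) < \<infinity>}) = 0"
    by (subst emeasure_compl) (auto simp: emeasure_finite)
  then have t_fin: "AE w in N. t (q w, S w) < \<infinity>"
    by (rule AE_I[rotated]) auto
  define \<tau> where "\<tau> p = max (snd p) (real_of_ereal (t p))" for p
  have \<tau> [measurable]: "\<tau> \<in> borel_measurable (borel \<Otimes>\<^sub>M borel)" unfolding \<tau>_def by measurable
  have \<tau>_t: "ereal (\<tau> (x, s)) = t (x, s)" if "t (x, s) < \<infinity>" for x s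
    using t_ge[of s x] that unfolding \<tau>_def by (cases "t (x, s)") auto
  have "distr N (borel \<Otimes>\<^sub>M borel) (\<lambda>w. (q w, \<tau> (q w, S w))) =
      distr N (borel \<Otimes>\<^sub>M borel) (\<lambda>w. (q w, E w))"
  proof (rule distr_Pair_eqI)
    fix e :: real
    have "AE w in N. \<tau> (q w, S w) < e \<longleftrightarrow> t (q w, S w) < ereal e"
      using t_fin by eventually_elim (simp flip: \<tau>_t)
    then have "law_on (\<lambda>w. \<tau> (q w, S w) < e) = law_on (\<lambda>w. t (q w, S w) < ereal e)"
      by (intro antisym law_on_mono_AE) auto
    then show "law_on (\<lambda>w. \<tau> (q w, S w) < e) = law_on (\<lambda>w. E w < e)"
      using t_law[of "ereal e"] by simp
  qed measurable
  then show ?thesis using that[OF \<tau>] unfolding \<tau>_def by simp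
qed

end

section \<open>Transport maps along the fibres\<close>

text \<open>The label \<open>\<phi>\<close> names the fibre of a source point and h its position; E is the position of
  the target, which together with the label determines the target.\<close>

locale fibred_plan = finite_measure N
  for N :: "('a::polish_space \<times> 'b::polish_space) measure" +
  fixes \<phi> :: "'a \<Rightarrow> 'c::polish_space" and h :: "'a \<Rightarrow> real" and E :: "'a \<times> 'b \<Rightarrow> real"
    and D :: "('a \<times> 'b) set"
  assumes sets_N [measurable_cong]: "sets N = sets (borel \<Otimes>\<^sub>M borel)"
    and \<phi> [measurable]: "\<phi> \<in> borel_measurable borel"
    and h [measurable]: "h \<in> borel_measurable borel"
    and E [measurable]: "E \<in> borel_measurable (borel \<Otimes>\<^sub>M borel)"
    and D: "D \<in> sets borel" and AE_D: "AE p in N. p \<in> D"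
    and h_le_E: "\<And>p. h (fst p) \<le> E p"
    and diffuse_h: "\<And>\<sigma> :: 'c \<Rightarrow> ereal. \<sigma> \<in> borel_measurable borel \<Longrightarrow>
      AE p in N. ereal (h (fst p)) \<noteq> \<sigma> (\<phi> (fst p))"
    and target_eq: "\<And>p p'. p \<in> D \<Longrightarrow> p' \<in> D \<Longrightarrow> \<phi> (fst p) = \<phi> (fst p') \<Longrightarrow> E p = E p' \<Longrightarrow> snd p = snd p'"
begin

sublocale diffuse_fibred_variable N "\<lambda>p. \<phi> (fst p)" "\<lambda>p. h (fst p)"
  by unfold_locales (measurable, rule diffuse_h)

lemma target_map_exists:
  obtains A g where "A \<in> sets (borel \<Otimes>\<^sub>M borel)" "g \<in> borel_measurable (borel \<Otimes>\<^sub>M borel)"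
    "AE p in N. (\<phi> (fst p), E p) \<in> A" "AE p in N. g (\<phi> (fst p), E p) = snd p"
    "\<And>z. z \<in> A \<Longrightarrow> \<exists>p\<in>D. z = (\<phi> (fst p), E p) \<and> g z = snd p"
proof -
  define u where "u p = (\<phi> (fst p), E p)" for p
  have sets_N': "sets N = sets borel" using sets_N unfolding borel_prod .
  have "u \<in> borel \<Otimes>\<^sub>M borel \<rightarrow>\<^sub>M borel \<Otimes>\<^sub>M borel" unfolding u_def by measurable
  then have u: "u \<in> borel_measurable borel" unfolding borel_prod .
  have snd: "(snd :: 'a \<times> 'b \<Rightarrow> 'b) \<in> borel_measurable borel"
    unfolding borel_prod[symmetric] by measurable
  have det: "snd p = snd p'" if "p \<in> D" "p' \<in> D" "u p = u p'" for p p'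
    using target_eq that unfolding u_def by blast
  obtain D' g where D': "D' \<in> sets borel" "D' \<subseteq> D" "AE p in N. p \<in> D \<longrightarrow> p \<in> D'"
    and borel: "u ` D' \<in> sets borel" "g \<in> borel_measurable borel"
    and g: "\<And>p. p \<in> D' \<Longrightarrow> g (u p) = snd p"
    using factor_through[OF finite_measure_axioms sets_N' u snd D det] by blast
  have "AE p in N. p \<in> D'" using AE_D D'(3) by eventually_elim blast
  then have "AE p in N. u p \<in> u ` D'" "AE p in N. g (u p) = snd p"
    by (eventually_elim, simp add: g)+
  moreover have "\<exists>p\<in>D. z = u p \<and> g z = snd p" if "z \<in> u ` D'" for z
    using that g D'(2) by blast
  ultimately show ?thesis
    using that[of "u ` D'" g] borel unfolding borel_prod u_def by blast
qed

lemma rearranging_map_exists: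
  obtains T \<tau> where "T \<in> borel_measurable borel" "\<tau> \<in> borel_measurable (borel \<Otimes>\<^sub>M borel)"
    "\<And>x s. s \<le> \<tau> (x, s)" "distr N borel (\<lambda>p. T (fst p)) = distr N borel snd"
    "distr N borel (\<lambda>p. \<tau> (\<phi> (fst p), h (fst p))) = distr N borel E"
    "AE p in N. \<exists>p'\<in>D. \<phi> (fst p) = \<phi> (fst p') \<and> \<tau> (\<phi> (fst p), h (fst p)) = E p' \<and>
      T (fst p) = snd p'"
proof -
  have "E \<in> borel_measurable N" by measurable
  then obtain \<tau> where \<tau> [measurable]: "\<tau> \<in> borel_measurable (borel \<Otimes>\<^sub>M borel)"
    and \<tau>_ge: "\<And>x s. s \<le> \<tau> (x, s)"
    and law: "distr N (borel \<Otimes>\<^sub>M borel) (\<lambda>p. (\<phi> (fst p), \<tau> (\<phi> (fst p), h (fst p)))) =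
      distr N (borel \<Otimes>\<^sub>M borel) (\<lambda>p. (\<phi> (fst p), E p))"
    using fibrewise_rearrangement[OF _ h_le_E] by blast
  define v where "v p = (\<phi> (fst p), \<tau> (\<phi> (fst p), h (fst p)))" for p :: "'a \<times> 'b"
  have v [measurable]: "v \<in> N \<rightarrow>\<^sub>M borel \<Otimes>\<^sub>M borel" unfolding v_def by measurable
  obtain A g where [measurable]: "A \<in> sets (borel \<Otimes>\<^sub>M borel)"
    "g \<in> borel_measurable (borel \<Otimes>\<^sub>M borel)"
    and AE_A: "AE p in N. (\<phi> (fst p), E p) \<in> A" and g: "AE p in N. g (\<phi> (fst p), E p) = snd p"
    and A: "\<And>z. z \<in> A \<Longrightarrow> \<exists>p\<in>D. z = (\<phi> (fst p), E p) \<and> g z = snd p"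
    using target_map_exists by blast
  define T where "T x = g (\<phi> x, \<tau> (\<phi> x, h x))" for x
  have T: "T \<in> borel_measurable borel" unfolding T_def by measurable
  have "distr N borel (\<lambda>p. T (fst p)) = distr (distr N (borel \<Otimes>\<^sub>M borel) v) borel g"
    by (subst distr_distr) (auto simp: comp_def T_def v_def)
  also have "\<dots> = distr N borel (\<lambda>p. g (\<phi> (fst p), E p))"
    unfolding v_def law by (subst distr_distr) (auto simp: comp_def)
  also have "\<dots> = distr N borel snd"
    using g by (intro distr_cong_AE) auto
  finally have push: "distr N borel (\<lambda>p. T (fst p)) = distr N borel snd" .
  have law_\<tau>: "distr N borel (\<lambda>p. \<tau> (\<phi> (fst p), h (fst p))) = distr N borel E"
    using arg_cong[OF law, of "\<lambda>L. distr L borel snd"] by (simp add: distr_distr comp_def)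
  have "AE z in distr N (borel \<Otimes>\<^sub>M borel) v. z \<in> A"
    unfolding v_def law using AE_A by (subst AE_distr_iff) auto
  then have "AE p in N. v p \<in> A" by (rule AE_distrD[OF v])
  then have "AE p in N. \<exists>p'\<in>D. \<phi> (fst p) = \<phi> (fst p') \<and> \<tau> (\<phi> (fst p), h (fst p)) = E p' \<and>
      T (fst p) = snd p'"
    by eventually_elim (use A in \<open>fastforce simp: v_def T_def\<close>)
  then show ?thesis using that T \<tau> \<tau>_ge push law_\<tau> by blast
qed

lemma transport_map_exists:
  assumes cost: "\<And>p p'. p \<in> D \<Longrightarrow> p' \<in> D \<Longrightarrow> \<phi> (fst p) = \<phi> (fst p') \<Longrightarrow> h (fst p) \<le> E p' \<Longrightarrow>
    c (fst p) (snd p') = ennreal (E p' - h (fst p))"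
  obtains T where "T \<in> borel_measurable borel" "distr N borel (\<lambda>p. T (fst p)) = distr N borel snd"
    "(\<integral>\<^sup>+p. c (fst p) (T (fst p)) \<partial>N) = (\<integral>\<^sup>+p. c (fst p) (snd p) \<partial>N)"
proof -
  obtain T \<tau> where T: "T \<in> borel_measurable borel"
    and \<tau> [measurable]: "\<tau> \<in> borel_measurable (borel \<Otimes>\<^sub>M borel)" and \<tau>_ge: "\<And>x s. s \<le> \<tau> (x, s)"
    and push: "distr N borel (\<lambda>p. T (fst p)) = distr N borel snd"
    and law: "distr N borel (\<lambda>p. \<tau> (\<phi> (fst p), h (fst p))) = distr N borel E"
    and image: "AE p in N. \<exists>p'\<in>D. \<phi> (fst p) = \<phi> (fst p') \<and> \<tau> (\<phi> (fst p), h (fst p)) = E p' \<and>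
        T (fst p) = snd p'"
    by (rule rearranging_map_exists, rule that)
  have "AE p in N. c (fst p) (T (fst p)) = ennreal (\<tau> (\<phi> (fst p), h (fst p)) - h (fst p))"
    using AE_D image
  proof eventually_elim
    case (elim p)
    then obtain p' where "p' \<in> D" "\<phi> (fst p) = \<phi> (fst p')" "\<tau> (\<phi> (fst p), h (fst p)) = E p'"
      "T (fst p) = snd p'"
      by blast
    then show ?case using cost elim(1) \<tau>_ge[of "h (fst p)" "\<phi> (fst p)"] by simp
  qed
  then have "(\<integral>\<^sup>+p. c (fst p) (T (fst p)) \<partial>N) =
      (\<integral>\<^sup>+p. ennreal (\<tau> (\<phi> (fst p), h (fst p)) - h (fst p)) \<partial>N)"
    by (rule nn_integral_cong_AE)
  also have "\<dots> = (\<integral>\<^sup>+p. ennreal (E p - h (fst p)) \<partial>N)"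
    by (rule nn_integral_diff_cong_distr[OF finite_measure_axioms _ _ _ \<tau>_ge h_le_E law]) measurable
  also have "\<dots> = (\<integral>\<^sup>+p. c (fst p) (snd p) \<partial>N)"
    using AE_D by (intro nn_integral_cong_AE, eventually_elim) (simp add: cost h_le_E)
  finally show ?thesis using that T push by blast
qed

end

lemma nn_integral_extend_by_identity:
  fixes \<pi> :: "('a::polish_space \<times> 'a) measure" and F :: "'a \<times> 'a \<Rightarrow> ennreal"
  assumes sets_\<pi> [measurable_cong]: "sets \<pi> = sets (borel \<Otimes>\<^sub>M borel)"
    and [measurable]: "X \<in> sets borel" "T \<in> borel_measurable borel"
      "F \<in> borel_measurable (borel \<Otimes>\<^sub>M borel)"
    and fixed: "AE p in \<pi>. fst p \<notin> X \<longrightarrow> snd p = fst p"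
    and eq: "(\<integral>\<^sup>+p. F (fst p, T (fst p)) \<partial>density \<pi> (indicator (X \<times> UNIV))) =
      (\<integral>\<^sup>+p. F p \<partial>density \<pi> (indicator (X \<times> UNIV)))"
  shows "(\<integral>\<^sup>+p. F (fst p, if fst p \<in> X then T (fst p) else fst p) \<partial>\<pi>) = (\<integral>\<^sup>+p. F p \<partial>\<pi>)"
proof -
  have XX [measurable]: "X \<times> UNIV \<in> sets (borel \<Otimes>\<^sub>M (borel :: 'a measure))" by measurable
  have split: "(\<integral>\<^sup>+p. H p \<partial>\<pi>) = (\<integral>\<^sup>+p. H p \<partial>density \<pi> (indicator (X \<times> UNIV))) +
      (\<integral>\<^sup>+p. indicator (- X) (fst p) * H p \<partial>\<pi>)"
    if [measurable]: "H \<in> borel_measurable \<pi>" for H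
  proof -
    have "(\<integral>\<^sup>+p. H p \<partial>\<pi>) =
        (\<integral>\<^sup>+p. indicator (X \<times> UNIV) p * H p + indicator (- X) (fst p) * H p \<partial>\<pi>)"
      by (intro nn_integral_cong) (auto simp: indicator_def)
    then show ?thesis by (simp add: nn_integral_add nn_integral_density)
  qed
  let ?T = "\<lambda>x. if x \<in> X then T x else x"
  have "(\<integral>\<^sup>+p. F (fst p, ?T (fst p)) \<partial>density \<pi> (indicator (X \<times> UNIV))) =
      (\<integral>\<^sup>+p. F (fst p, T (fst p)) \<partial>density \<pi> (indicator (X \<times> UNIV)))"
    by (intro nn_integral_cong_AE) (subst AE_density, auto split: split_indicator)
  moreover have "(\<integral>\<^sup>+p. indicator (- X) (fst p) * F (fst p, ?T (fst p)) \<partial>\<pi>) =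
      (\<integral>\<^sup>+p. indicator (- X) (fst p) * F p \<partial>\<pi>)"
    using fixed by (intro nn_integral_cong_AE, eventually_elim) (auto split: split_indicator)
  moreover have "(\<lambda>p. F (fst p, ?T (fst p))) \<in> borel_measurable \<pi>" "F \<in> borel_measurable \<pi>"
    by measurable
  note this[THEN split]
  ultimately show ?thesis using eq by simp
qed

lemma transport_map_extend_by_identity:
  fixes \<pi> :: "('a::polish_space \<times> 'a) measure" and c :: "'a \<Rightarrow> 'a \<Rightarrow> ennreal"
  assumes sets_\<pi> [measurable_cong]: "sets \<pi> = sets (borel \<Otimes>\<^sub>M borel)"
    and X [measurable]: "X \<in> sets borel" and T [measurable]: "T \<in> borel_measurable borel"
    and c [measurable]: "(\<lambda>p. c (fst p) (snd p)) \<in> borel_measurable (borel \<Otimes>\<^sub>M borel)"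
    and fixed: "AE p in \<pi>. fst p \<notin> X \<longrightarrow> snd p = fst p"
    and N_def: "N = density \<pi> (indicator (X \<times> UNIV))"
    and push: "distr N borel (\<lambda>p. T (fst p)) = distr N borel snd"
    and cost: "(\<integral>\<^sup>+p. c (fst p) (T (fst p)) \<partial>N) = (\<integral>\<^sup>+p. c (fst p) (snd p) \<partial>N)"
  defines "T' \<equiv> \<lambda>x. if x \<in> X then T x else x"
  shows "T' \<in> borel_measurable borel" "distr (distr \<pi> borel fst) borel T' = distr \<pi> borel snd"
    "(\<integral>\<^sup>+x. c x (T' x) \<partial>distr \<pi> borel fst) = (\<integral>\<^sup>+p. c (fst p) (snd p) \<partial>\<pi>)"
proof -
  show T' [measurable]: "T' \<in> borel_measurable borel" unfolding T'_def by measurable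
  have extend: "(\<integral>\<^sup>+p. F (fst p, T' (fst p)) \<partial>\<pi>) = (\<integral>\<^sup>+p. F p \<partial>\<pi>)"
    if "F \<in> borel_measurable (borel \<Otimes>\<^sub>M borel)" "(\<integral>\<^sup>+p. F (fst p, T (fst p)) \<partial>N) = (\<integral>\<^sup>+p. F p \<partial>N)"
    for F
    using nn_integral_extend_by_identity[OF sets_\<pi> X T that(1) fixed] that(2)
    unfolding N_def T'_def .
  have [measurable_cong]: "sets N = sets (borel \<Otimes>\<^sub>M borel)" unfolding N_def by (simp add: sets_\<pi>)
  have integral_distr: "(\<integral>\<^sup>+p. indicator C (w p) \<partial>M) = emeasure (distr M borel w) C"
    if "w \<in> borel_measurable M" "C \<in> sets borel"
    for C :: "'a set" and w :: "'a \<times> 'a \<Rightarrow> 'a" and M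
    using nn_integral_distr[OF that(1), of "indicator C"] that(2) by simp
  have "emeasure (distr \<pi> borel (\<lambda>p. T' (fst p))) C = emeasure (distr \<pi> borel snd) C"
    if [measurable]: "C \<in> sets borel" for C
    using extend[of "\<lambda>p. indicator C (snd p)"] push by (simp add: integral_distr)
  then show "distr (distr \<pi> borel fst) borel T' = distr \<pi> borel snd"
    by (subst distr_distr) (auto simp: comp_def intro: measure_eqI)
  have "(\<integral>\<^sup>+x. c x (T' x) \<partial>distr \<pi> borel fst) = (\<integral>\<^sup>+p. c (fst p) (T' (fst p)) \<partial>\<pi>)"
    using measurable_compose[OF measurable_Pair[OF measurable_ident T'] c]
    by (subst nn_integral_distr) auto
  also have "\<dots> = (\<integral>\<^sup>+p. c (fst p) (snd p) \<partial>\<pi>)"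
    using extend[OF c] cost by simp
  finally show "(\<integral>\<^sup>+x. c x (T' x) \<partial>distr \<pi> borel fst) = (\<integral>\<^sup>+p. c (fst p) (snd p) \<partial>\<pi>)" .
qed

section \<open>Null sets of ray sections\<close>

locale ray_measure = ray_section dL \<Gamma> f
  for dL :: "'a::polish_space \<Rightarrow> 'a \<Rightarrow> ennreal" and \<Gamma> f +
  fixes \<mu> :: "'a measure"
  assumes sets_\<mu>: "sets \<mu> = sets borel" and finite_\<mu>: "finite_measure \<mu>"
    and f_measurable: "mu_measurable_on \<mu> T f"
    and translates: "\<And>A. A \<in> sets borel \<Longrightarrow> A \<subseteq> Teset dL \<Gamma> \<Longrightarrow> emeasure \<mu> A > 0 \<Longrightarrow>
      uncountable {t::real. t > 0 \<and> emeasure (completion \<mu>) (translate_set dL \<Gamma> f A t) > 0}"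
begin

abbreviation translate :: "'a set \<Rightarrow> real \<Rightarrow> 'a set" where
  "translate \<equiv> translate_set dL \<Gamma> f"

lemma T_sets: "T \<in> sets (completion \<mu>)"
  using f_measurable[unfolded mu_measurable_on_def, rule_format, of UNIV] by simp

lemma null_if_countable_translates:
  assumes "A \<in> sets borel" "A \<subseteq> Teset dL \<Gamma>"
    and "countable {t. 0 < t \<and> 0 < emeasure (completion \<mu>) (translate A t)}"
  shows "emeasure \<mu> A = 0"
  using translates[OF assms(1,2)] assms(3) by (auto simp: zero_less_iff_neq_zero)

lemma terminal_points_null:
  assumes "A \<in> sets borel" "A \<subseteq> Teset dL \<Gamma>" and terminal: "\<And>a x. a \<in> A \<Longrightarrow> (a, x) \<in> G \<Longrightarrow> x = a"
  shows "emeasure \<mu> A = 0"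
proof (rule null_if_countable_translates[OF assms(1,2)])
  have "translate A t = {}" if "0 < t" for t
  proof (rule equals0I)
    fix x assume "x \<in> translate A t"
    then obtain a where "a \<in> A" "(a, x) \<in> G" "dL a x = ennreal t"
      using \<open>0 < t\<close> by (auto elim: translate_setE)
    then show False using terminal \<open>0 < t\<close> by fastforce
  qed
  then have "{t. 0 < t \<and> 0 < emeasure (completion \<mu>) (translate A t)} = {}" by auto
  then show "countable {t. 0 < t \<and> 0 < emeasure (completion \<mu>) (translate A t)}"
    by (simp only: countable_empty)
qed

lemma translate_outside_T_null:
  assumes "translate A t \<in> sets (completion \<mu>)" "0 < t"
  shows "emeasure (completion \<mu>) (translate A t - T) = 0"
proof -
  have diff: "translate A t - T \<in> sets (completion \<mu>)" using assms(1) T_sets by auto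
  define C where "C = main_part \<mu> (translate A t - T)"
  have sub: "C \<subseteq> translate A t - T"
    unfolding C_def using main_part_null_part_Un[OF diff] by blast
  have pred: "\<exists>a. (a, x) \<in> G \<and> a \<noteq> x" if x: "x \<in> C" for x
  proof -
    obtain a where "(a, x) \<in> G" "dL a x = ennreal t"
      using translate_setE[of x A t] x sub \<open>0 < t\<close> by (metis DiffD1 less_imp_le subsetD)
    then show ?thesis using \<open>0 < t\<close> by (intro exI[of _ a]) auto
  qed
  have "emeasure \<mu> C = 0"
  proof (rule terminal_points_null)
    show "C \<in> sets borel" unfolding C_def using main_part_sets[OF diff] sets_\<mu> by simp
    show "C \<subseteq> Teset dL \<Gamma>" using pred unfolding Teset_def by blast
    fix c x assume "c \<in> C" "(c, x) \<in> G"
    then show "x = c" using pred[of c] sub unfolding Tset_def by blast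
  qed
  then show ?thesis
    unfolding C_def using emeasure_completion[OF diff] by simp
qed

lemma partial_section_null:
  assumes "A \<in> sets borel" "A \<subseteq> Teset dL \<Gamma>"
    and unique: "\<And>x a a'. x \<in> T \<Longrightarrow> a \<in> A \<Longrightarrow> a' \<in> A \<Longrightarrow> (a, x) \<in> G \<Longrightarrow> (a', x) \<in> G \<Longrightarrow> a = a'"
  shows "emeasure \<mu> A = 0"
proof (rule null_if_countable_translates[OF assms(1,2)])
  interpret finite_measure \<mu> by (rule finite_\<mu>)
  interpret completion: finite_measure "completion \<mu>" by (rule finite_measureI) simp
  let ?I = "{t. 0 < t \<and> 0 < emeasure (completion \<mu>) (translate A t)}"
  show "countable ?I"
  proof (rule completion.countable_positive_disjoint_family)
    show "disjoint_family_on (\<lambda>t. translate A t \<inter> T) ?I"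
      unfolding disjoint_family_on_def
    proof (intro ballI impI equals0I)
      fix t t' x
      assume t: "t \<in> ?I" "t' \<in> ?I" "t \<noteq> t'" and x: "x \<in> translate A t \<inter> T \<inter> (translate A t' \<inter> T)"
      obtain a where a: "a \<in> A" "(a, x) \<in> G" "dL a x = ennreal t"
        using x t(1) by (auto elim: translate_setE)
      obtain a' where a': "a' \<in> A" "(a', x) \<in> G" "dL a' x = ennreal t'"
        using x t(2) by (auto elim: translate_setE)
      have "a = a'" using unique a(1,2) a'(1,2) x by blast
      then show False using a(3) a'(3) t by simp
    qed
  next
    fix t assume t: "t \<in> ?I"
    then have At: "translate A t \<in> sets (completion \<mu>)"
      using emeasure_notin_sets[of "translate A t" "completion \<mu>"] by force
    then show AtT: "translate A t \<inter> T \<in> sets (completion \<mu>)" using T_sets by auto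
    have "emeasure (completion \<mu>) (translate A t) =
        emeasure (completion \<mu>) (translate A t \<inter> T) + emeasure (completion \<mu>) (translate A t - T)"
      using plus_emeasure[OF AtT, of "translate A t - T"] At T_sets
      by (simp add: Int_Diff_Un Int_Diff_disjoint)
    then show "0 < emeasure (completion \<mu>) (translate A t \<inter> T)"
      using t translate_outside_T_null[OF At] by simp
  qed
qed

lemma initial_points_null:
  assumes "A \<in> sets borel" "A \<inter> T = {}" and succ: "\<And>a. a \<in> A \<Longrightarrow> \<exists>y. (a, y) \<in> G \<and> a \<noteq> y"
  shows "emeasure \<mu> A = 0"
proof (rule partial_section_null[OF assms(1)])
  show "A \<subseteq> Teset dL \<Gamma>" using succ unfolding Teset_def by blast
  have no_pred: "b = a" if "a \<in> A" "(b, a) \<in> G" for a b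
    using succ[OF that(1)] assms(2) that unfolding Tset_def by blast
  fix x a a' assume x: "x \<in> T" and a: "a \<in> A" "a' \<in> A" "(a, x) \<in> G" "(a', x) \<in> G"
  obtain p where "(x, p) \<in> G" "x \<noteq> p" using x unfolding Tset_def by blast
  then have "(a', a) \<in> G \<or> (a, a') \<in> G"
    using backward_linear[of x p a a'] backward_linear[of x p a' a] a(3,4)
    by (cases "dL a x \<le> dL a' x") auto
  then show "a = a'" using no_pred a(1,2) by blast
qed

end

section \<open>The transport map\<close>

locale ray_plan = ray_measure dL \<Gamma> f \<mu>
  for dL :: "'a::polish_space \<Rightarrow> 'a \<Rightarrow> ennreal" and \<Gamma> f \<mu> +
  fixes \<pi> :: "('a \<times> 'a) measure"
  assumes finite_\<pi>: "finite_measure \<pi>"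
    and sets_\<pi> [measurable_cong]: "sets \<pi> = sets (borel \<Otimes>\<^sub>M borel)"
    and marginal: "distr \<pi> borel fst = \<mu>"
    and \<Gamma>_sigma_compact: "sigma_compact \<Gamma>" and \<pi>_concentrated: "emeasure \<pi> (UNIV - \<Gamma>) = 0"
    and dL_borel: "(\<lambda>p. dL (fst p) (snd p)) \<in> borel_measurable (borel \<Otimes>\<^sub>M borel)"
begin

lemma dL_measurable [measurable (raw)]:
  assumes "u \<in> M \<rightarrow>\<^sub>M borel" "v \<in> M \<rightarrow>\<^sub>M borel"
  shows "(\<lambda>w. dL (u w) (v w)) \<in> borel_measurable M"
  using measurable_compose[OF measurable_Pair[OF assms] dL_borel] by simp

lemma \<Gamma>_sets [measurable]: "\<Gamma> \<in> sets (borel \<Otimes>\<^sub>M borel)"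
proof -
  obtain K where "\<And>n::nat. compact (K n)" "\<Gamma> = (\<Union>n. K n)"
    using \<Gamma>_sigma_compact unfolding sigma_compact_def by blast
  then show ?thesis unfolding borel_prod by (auto intro: borel_compact)
qed

lemma AE_\<Gamma>: "AE p in \<pi>. p \<in> \<Gamma>"
proof -
  have "UNIV - \<Gamma> \<in> sets borel" using \<Gamma>_sets unfolding borel_prod by auto
  then have "UNIV - \<Gamma> \<in> sets \<pi>" unfolding sets_\<pi> borel_prod .
  then show ?thesis using \<pi>_concentrated by (intro AE_I) auto
qed

lemma AE_source:
  assumes "A \<in> sets borel" "emeasure \<mu> A = 0"
  shows "AE p in \<pi>. fst p \<notin> A"
proof -
  have "AE x in distr \<pi> borel fst. x \<notin> A"
    unfolding marginal using assms sets_\<mu> by (intro AE_not_in null_setsI) auto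
  then show ?thesis by (rule AE_distrD[rotated]) measurable
qed

lemma AE_moving_source:
  assumes S: "S \<in> sets borel" "T - S \<in> null_sets (completion \<mu>)"
  shows "AE p in \<pi>. fst p \<noteq> snd p \<longrightarrow> fst p \<in> S"
proof -
  obtain Z where Z: "Z \<in> null_sets \<mu>" "T - S \<subseteq> Z"
    using S(2) unfolding null_sets_completion_iff2 by blast
  have [measurable]: "Z \<in> sets borel" "S \<in> sets borel" using Z(1) S(1) sets_\<mu> by auto
  define D where "D = {p. p \<in> \<Gamma> \<and> fst p \<noteq> snd p \<and> fst p \<notin> S \<union> Z}"
  have D: "D \<in> sets borel" unfolding D_def by (rule pred_Collect_borel_prod) measurable
  have sets_\<pi>': "sets \<pi> = sets borel" using sets_\<pi> unfolding borel_prod .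
  have "AE p in \<pi>. p \<notin> D"
  proof (rule AE_not_in_if_compact_projections_null[OF finite_\<pi> sets_\<pi>' D])
    fix K assume K: "compact K" "K \<subseteq> D"
    show "emeasure (distr \<pi> borel fst) (fst ` K) = 0"
      unfolding marginal
    proof (rule initial_points_null)
      show "fst ` K \<in> sets borel"
        using K(1) by (intro borel_compact compact_continuous_image continuous_intros)
      show "fst ` K \<inter> T = {}" using K(2) Z(2) unfolding D_def by force
      show "\<exists>y. (a, y) \<in> G \<and> a \<noteq> y" if "a \<in> fst ` K" for a
        using that K(2) \<Gamma>_subset_Gset unfolding D_def by force
    qed
  qed
  moreover have "AE p in \<pi>. fst p \<notin> Z"
    using Z(1) by (intro AE_source) auto
  ultimately show ?thesis using AE_\<Gamma> unfolding D_def by eventually_elim auto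
qed

lemma borel_position_exists:
  assumes [measurable]: "S \<in> sets borel" "f' \<in> borel_measurable borel"
    and "S \<subseteq> T" and f': "\<And>x. x \<in> S \<Longrightarrow> f' x = f x"
  obtains X h where "X \<in> sets borel" "X \<subseteq> S" "h \<in> borel_measurable borel"
    "\<And>x. x \<in> X \<Longrightarrow> h x = position x" "AE p in \<pi>. fst p \<in> S \<and> fst p \<noteq> snd p \<longrightarrow> fst p \<in> X"
proof -
  define D where "D = {p. p \<in> \<Gamma> \<and> fst p \<noteq> snd p \<and> fst p \<in> S}"
  have D: "D \<in> sets borel" unfolding D_def by (rule pred_Collect_borel_prod) measurable
  define v where "v p = (if dL (f' (fst p)) (snd p) = dL (f' (fst p)) (fst p) + dL (fst p) (snd p)
    then enn2real (dL (f' (fst p)) (fst p)) else - enn2real (dL (f' (fst p)) (fst p)))" for p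
  have "v \<in> borel_measurable (borel \<Otimes>\<^sub>M borel)" unfolding v_def by measurable
  then have v: "v \<in> borel_measurable borel" unfolding borel_prod .
  have fst_borel: "(fst :: 'a \<times> 'a \<Rightarrow> 'a) \<in> borel_measurable borel"
    unfolding borel_prod[symmetric] by measurable
  have v_position: "v p = position (fst p)" if "p \<in> D" for p
  proof -
    have "fst p \<in> T" "(fst p, snd p) \<in> G" "fst p \<noteq> snd p" "f' (fst p) = f (fst p)"
      using that \<Gamma>_subset_Gset \<open>S \<subseteq> T\<close> f' unfolding D_def by auto
    then show ?thesis using position_eq_dist[of "fst p" "snd p"] unfolding v_def by simp
  qed
  then have det: "v p = v p'" if "p \<in> D" "p' \<in> D" "fst p = fst p'" for p p'
    using that by simp
  have sets_\<pi>': "sets \<pi> = sets borel" using sets_\<pi> unfolding borel_prod .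
  obtain D' h where D': "D' \<in> sets borel" "D' \<subseteq> D" "AE p in \<pi>. p \<in> D \<longrightarrow> p \<in> D'"
    and h: "fst ` D' \<in> sets borel" "h \<in> borel_measurable borel" "\<And>p. p \<in> D' \<Longrightarrow> h (fst p) = v p"
    using factor_through[OF finite_\<pi> sets_\<pi>' fst_borel v D det] by blast
  have "AE p in \<pi>. fst p \<in> S \<and> fst p \<noteq> snd p \<longrightarrow> fst p \<in> fst ` D'"
    using D'(3) AE_\<Gamma> by eventually_elim (auto simp: D_def)
  moreover have "fst ` D' \<subseteq> S" using D'(2) unfolding D_def by auto
  moreover have "h x = position x" if "x \<in> fst ` D'" for x
    using that h(3) v_position D'(2) by auto
  ultimately show ?thesis using that[of "fst ` D'" h] h(1,2) by blast
qed

lemma borel_coordinates_exist: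
  obtains X f' h where "X \<in> sets borel" "X \<subseteq> T" "f' \<in> borel_measurable borel"
    "h \<in> borel_measurable borel"
    "\<And>x. x \<in> X \<Longrightarrow> f' x = f x" "\<And>x. x \<in> X \<Longrightarrow> h x = position x"
    "AE p in \<pi>. fst p \<notin> X \<longrightarrow> snd p = fst p"
proof -
  obtain S f' where S: "S \<in> sets borel" "S \<subseteq> T" "T - S \<in> null_sets (completion \<mu>)"
    and f': "f' \<in> borel_measurable borel" "\<And>x. x \<in> S \<Longrightarrow> f' x = f x"
    using mu_measurable_on_borel_version[OF sets_\<mu> f_measurable] by blast
  obtain X h where X: "X \<in> sets borel" "X \<subseteq> S" "h \<in> borel_measurable borel"
    "\<And>x. x \<in> X \<Longrightarrow> h x = position x" "AE p in \<pi>. fst p \<in> S \<and> fst p \<noteq> snd p \<longrightarrow> fst p \<in> X"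
    using borel_position_exists[OF S(1) f'(1) S(2) f'(2)] by blast
  have "AE p in \<pi>. fst p \<notin> X \<longrightarrow> snd p = fst p"
    using X(5) AE_moving_source[OF S(1,3)] by eventually_elim auto
  then show ?thesis using that[of X f' h] X f' S(2) by blast
qed

lemma AE_position_neq:
  assumes [measurable]: "X \<in> sets borel" "f' \<in> borel_measurable borel" "h \<in> borel_measurable borel"
    "\<sigma> \<in> borel_measurable borel"
    and "X \<subseteq> T" and f': "\<And>x. x \<in> X \<Longrightarrow> f' x = f x" and h: "\<And>x. x \<in> X \<Longrightarrow> h x = position x"
  shows "AE p in \<pi>. fst p \<in> X \<longrightarrow> ereal (h (fst p)) \<noteq> \<sigma> (f' (fst p))"
proof -
  define A where "A = {x. x \<in> X \<and> ereal (h x) = \<sigma> (f' x)}"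
  have A: "A \<in> sets borel" unfolding A_def by measurable
  have "emeasure \<mu> A = 0"
  proof (rule partial_section_null[OF A])
    show "A \<subseteq> Teset dL \<Gamma>" using \<open>X \<subseteq> T\<close> unfolding A_def Tset_def Teset_def by blast
    fix x a a' assume x: "x \<in> T" and a: "a \<in> A" "a' \<in> A" "(a, x) \<in> G" "(a', x) \<in> G"
    then have X: "a \<in> X" "a' \<in> X" and T: "a \<in> T" "a' \<in> T"
      and level: "ereal (h a) = \<sigma> (f' a)" "ereal (h a') = \<sigma> (f' a')"
      using \<open>X \<subseteq> T\<close> unfolding A_def by auto
    have f_eq: "f a = f a'"
      using section_eq[OF T(1) x a(3)] section_eq[OF T(2) x a(4)] by simp
    then have "ereal (h a) = ereal (h a')" using level f' X by metis
    then show "a = a'" using position_inj[OF T f_eq] h X by simp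
  qed
  with A have "AE p in \<pi>. fst p \<notin> A" by (rule AE_source)
  then show ?thesis by eventually_elim (simp add: A_def)
qed

lemma AE_moving_part:
  assumes [measurable]: "X \<in> sets borel"
  shows "(AE p in density \<pi> (indicator (X \<times> UNIV)). P p) \<longleftrightarrow> (AE p in \<pi>. fst p \<in> X \<longrightarrow> P p)"
  by (subst AE_density) (auto simp: indicator_def mem_Times_iff)

theorem transport_map_exists:
  obtains F where "F \<in> borel_measurable borel" "distr \<mu> borel F = distr \<pi> borel snd"
    "(\<integral>\<^sup>+x. dL x (F x) \<partial>\<mu>) = (\<integral>\<^sup>+p. dL (fst p) (snd p) \<partial>\<pi>)"
proof -
  obtain X f' h where X [measurable]: "X \<in> sets borel" and "X \<subseteq> T"
    and [measurable]: "f' \<in> borel_measurable borel" "h \<in> borel_measurable borel"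
    and f': "\<And>x. x \<in> X \<Longrightarrow> f' x = f x" and h: "\<And>x. x \<in> X \<Longrightarrow> h x = position x"
    and fixed: "AE p in \<pi>. fst p \<notin> X \<longrightarrow> snd p = fst p"
    by (rule borel_coordinates_exist, rule that)
  define N where "N = density \<pi> (indicator (X \<times> UNIV))"
  define E where "E p = h (fst p) + enn2real (dL (fst p) (snd p))" for p
  define D where "D = {p \<in> \<Gamma>. fst p \<in> X}"
  have D: "fst p \<in> T" "(fst p, snd p) \<in> G" "f' (fst p) = f (fst p)"
    "E p = position (fst p) + enn2real (dL (fst p) (snd p))" "h (fst p) = position (fst p)"
    if "p \<in> D" for p
    using that \<open>X \<subseteq> T\<close> \<Gamma>_subset_Gset f' h unfolding D_def E_def by auto
  interpret N: fibred_plan N f' h E D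
  proof (intro fibred_plan.intro fibred_plan_axioms.intro)
    show "finite_measure N"
      unfolding N_def by (intro finite_measure.finite_measure_restricted[OF finite_\<pi>]) measurable
    show "sets N = sets (borel \<Otimes>\<^sub>M borel)" unfolding N_def by (simp add: sets_\<pi>)
    show "E \<in> borel_measurable (borel \<Otimes>\<^sub>M borel)" unfolding E_def by measurable
    show "D \<in> sets borel" unfolding D_def by (rule pred_Collect_borel_prod) measurable
    show "AE p in N. p \<in> D"
      unfolding N_def AE_moving_part[OF X] using AE_\<Gamma> by eventually_elim (simp add: D_def)
    show "h (fst p) \<le> E p" for p unfolding E_def by simp
    show "AE p in N. ereal (h (fst p)) \<noteq> \<sigma> (f' (fst p))" if "\<sigma> \<in> borel_measurable borel" for \<sigma>
      unfolding N_def AE_moving_part[OF X] using that \<open>X \<subseteq> T\<close> f' h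
      by (intro AE_position_neq) measurable
    show "snd p = snd p'" if "p \<in> D" "p' \<in> D" "f' (fst p) = f' (fst p')" "E p = E p'" for p p'
      using target_unique[of "fst p" "fst p'"] D[OF that(1)] D[OF that(2)] that(3,4) by simp
  qed measurable
  have "dL (fst p) (snd p') = ennreal (E p' - h (fst p))"
    if "p \<in> D" "p' \<in> D" "f' (fst p) = f' (fst p')" "h (fst p) \<le> E p'" for p p'
    using dist_to_target[of "fst p" "fst p'" "snd p'"] D[OF that(1)] D[OF that(2)] that(3,4) by simp
  then obtain F where F: "F \<in> borel_measurable borel"
    "distr N borel (\<lambda>p. F (fst p)) = distr N borel snd"
    "(\<integral>\<^sup>+p. dL (fst p) (F (fst p)) \<partial>N) = (\<integral>\<^sup>+p. dL (fst p) (snd p) \<partial>N)"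
    using N.transport_map_exists[of dL] by blast
  show ?thesis
    using that transport_map_extend_by_identity[OF sets_\<pi> _ F(1) dL_borel fixed N_def F(2,3)]
    unfolding marginal by simp
qed

end

theorem theorem6p2:
  fixes dL :: "'a::polish_space \<Rightarrow> 'a \<Rightarrow> ennreal"
    and \<mu> \<nu> :: "'a measure"
    and \<pi> :: "('a \<times> 'a) measure"
    and \<Gamma> :: "('a \<times> 'a) set"
    and f :: "'a \<Rightarrow> 'a"
  assumes std: "standing_assumptions dL"
    and sets_\<mu>: "sets \<mu> = sets borel" and prob_\<mu>: "prob_space \<mu>"
    and sets_\<nu>: "sets \<nu> = sets borel" and prob_\<nu>: "prob_space \<nu>"
    and sets_\<pi>: "sets \<pi> = sets (borel \<Otimes>\<^sub>M borel)"
    and marg1: "distr \<pi> borel fst = \<mu>"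
    and marg2: "distr \<pi> borel snd = \<nu>"
    and \<Gamma>_sc: "sigma_compact \<Gamma>"
    and \<Gamma>_cm: "cyclically_monotone dL \<Gamma>"
    and \<Gamma>_fin: "\<Gamma> \<subseteq> {(x, y). dL x y < \<infinity>}"
    and \<pi>_conc: "emeasure \<pi> (UNIV - \<Gamma>) = 0"
    and cost_fin: "(\<integral>\<^sup>+ p. dL (fst p) (snd p) \<partial>\<pi>) < \<infinity>"
    and f_cs: "cross_section (Rrel dL \<Gamma>) (Tset dL \<Gamma>) f"
    and f_meas: "mu_measurable_on \<mu> (Tset dL \<Gamma>) f"
    and hyp: "\<And>A. A \<in> sets borel \<Longrightarrow> A \<subseteq> Teset dL \<Gamma> \<Longrightarrow> emeasure \<mu> A > 0 \<Longrightarrow>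
       uncountable {t::real. t > 0 \<and> emeasure (completion \<mu>) (translate_set dL \<Gamma> f A t) > 0}"
  shows "\<exists>T. T \<in> borel_measurable borel \<and> distr \<mu> borel T = \<nu> \<and>
           (\<integral>\<^sup>+ x. dL x (T x) \<partial>\<mu>) = (\<integral>\<^sup>+ p. dL (fst p) (snd p) \<partial>\<pi>)"
proof -
  interpret \<mu>: prob_space \<mu> by (fact prob_\<mu>)
  interpret \<pi>: prob_space \<pi>
    by (rule prob_space_distrD[of fst \<pi> borel])
      (simp_all add: marg1 prob_\<mu> cong: measurable_cong_sets[OF sets_\<pi>])
  interpret ray_plan dL \<Gamma> f \<mu> \<pi>
  proof
    show "ext_distance dL" "geodesic_space dL" "non_branching dL"
      "(\<lambda>p. dL (fst p) (snd p)) \<in> borel_measurable (borel \<Otimes>\<^sub>M borel)"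
      using std unfolding standing_assumptions_def by blast+
  qed (fact \<Gamma>_cm \<Gamma>_fin f_cs sets_\<mu> f_meas hyp sets_\<pi> marg1 \<Gamma>_sc \<pi>_conc)+
  show ?thesis
    using transport_map_exists unfolding marg2 by blast
qed

end
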